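(* Let $n\geq 3$, $2<\gamma<n$, $\alpha,\beta\in\mathbb{R}$, $0<p_0<\infty$, $0<q_0<\infty$. Suppose there exists a pair of $C^1$ positive functions $(u,v)\in L^{p_0+1}(\partial\mathbb{R}^n_+,|\xi|^{-\alpha}d\xi)\times L^{q_0+1}(\mathbb{R}^n_+,|x|^{-\beta}dx)$ solving $$u(\xi)=\int_{\mathbb{R}^n_{+}} P(x,\xi,\gamma) |x|^{-\beta} v^{q_0}(x)dx,\ \ \xi\in \partial \mathbb{R}^n_{+},\qquad v(x)=\int_{\partial\mathbb{R}^n_+} P(x,\xi,\gamma) |\xi|^{-\alpha} u^{p_0}(\xi)d\xi, \ \ x\in \mathbb{R}^n_{+}.$$ Then necessarily $$\frac{n-1-\alpha}{p_0+1}+\frac{n-\beta}{q_0+1}=n+1-\gamma.$$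
   Context: $\mathbb{R}^n_+=\{x=(x',x_n)\in\mathbb{R}^{n-1}\times\mathbb{R}: x_n>0\}$, $\partial\mathbb{R}^n_+\cong\mathbb{R}^{n-1}$. $P(x,\xi,\gamma)=\frac{x_n}{(|x'-\xi|^2+x_n^2)^{\frac{n+2-\gamma}{2}}}$. $L^{r}(\Omega,w\,dx)$ denotes the $L^r$ space with respect to the weighted measure $w\,dx$. *)

theory Defs
  imports "HOL-Analysis.Analysis"
begin

text \<open>Points of R^n are pairs (x', x_n) with x' in R^(n-1) = real^'m, so n = CARD('m) + 1.
  The upper half space R^n_+ is {x. snd x > 0}; its boundary is identified with real^'m.\<close>

definition upper_half :: "((real^'m) \<times> real) set" where
  "upper_half = {x. snd x > 0}"

definition Pker :: "(real^'m) \<times> real \<Rightarrow> real^'m \<Rightarrow> real \<Rightarrow> real" where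
  "Pker x \<xi> \<gamma> = snd x / ((norm (fst x - \<xi>))\<^sup>2 + (snd x)\<^sup>2)
       powr ((real (CARD('m) + 1) + 2 - \<gamma>) / 2)"

definition C1_on :: "'a::real_normed_vector set \<Rightarrow> ('a \<Rightarrow> real) \<Rightarrow> bool" where
  "C1_on S f \<longleftrightarrow> (\<exists>D. (\<forall>x\<in>S. (f has_derivative blinfun_apply (D x)) (at x)) \<and> continuous_on S D)"

end

theory Submission
  imports Defs
begin

text \<open>Write \<open>f = |\<xi>|\<^sup>-\<^sup>\<alpha> u\<^sup>p\<close>, \<open>g = |x|\<^sup>-\<^sup>\<beta> v\<^sup>q\<close>, and let \<open>f\<^sub>t\<close>, \<open>g\<^sub>t\<close> be their dilations by \<open>exp t\<close>, normalised so
  that the weighted norms of \<open>u\<close> and \<open>v\<close> are preserved. With \<open>E(f, g) = \<integral>\<integral> P f g\<close>, homogeneity of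
  the kernel gives \<open>E(f\<^sub>t, g\<^sub>t) = exp (-\<delta>t) E(f, g)\<close>, where \<open>\<delta>\<close> is the difference of the two sides of
  the claim, while \<open>E(f\<^sub>t - f, g)\<close> and \<open>E(f, g\<^sub>t - g)\<close> are nonpositive by Young's inequality. To make
  \<open>E(f\<^sub>t - f, g\<^sub>t - g) = o(t)\<close>, the differences are multiplied by a logarithmic cutoff \<open>\<phi>\<^sub>R\<close>: on its
  support \<open>|f\<^sub>t - f| \<le> M|t|f\<close> because \<open>u\<close> is \<open>C\<^sup>1\<close>, and \<open>\<integral>|g\<^sub>t - g| v \<rightarrow> 0\<close>. The cutoff enters as
  \<open>\<phi>\<^sub>R(\<xi>)\<close> in one difference and as \<open>\<phi>\<^sub>R(x)\<close> in the other, and the singularity of \<open>\<partial>P\<close> on the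
  diagonal is absorbed by \<open>\<phi>\<^sub>R(x) - \<phi>\<^sub>R(\<xi>)\<close>, so all errors are \<open>|t|\<close> times a quantity that vanishes as
  \<open>R \<rightarrow> \<infinity>\<close>. Choosing the sign of \<open>t\<close> so that \<open>-\<delta>t = |\<delta>||t|\<close> forces \<open>\<delta> = 0\<close>.\<close>

section \<open>Lebesgue measure under dilations\<close>

lemma nn_integral_lborel_scaleR:
  fixes f :: "'a::euclidean_space \<Rightarrow> ennreal"
  assumes [measurable]: "f \<in> borel_measurable borel" and c: "c > 0"
  shows "(\<integral>\<^sup>+x. f x \<partial>lborel) = ennreal (c ^ DIM('a)) * (\<integral>\<^sup>+x. f (c *\<^sub>R x) \<partial>lborel)"
  by (subst lborel_affine[of c 0])
     (use c in \<open>simp_all add: nn_integral_density nn_integral_distr nn_integral_cmult\<close>)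

lemma integral_lborel_scaleR:
  fixes f :: "'a::euclidean_space \<Rightarrow> real"
  assumes [measurable]: "f \<in> borel_measurable borel" and c: "c > 0"
  shows "(\<integral>x. f x \<partial>lborel) = c ^ DIM('a) * (\<integral>x. f (c *\<^sub>R x) \<partial>lborel)"
    and "integrable lborel (\<lambda>x. f (c *\<^sub>R x)) \<longleftrightarrow> integrable lborel f"
proof -
  have eq: "lborel = density (distr lborel borel (\<lambda>x::'a. c *\<^sub>R x)) (\<lambda>_. ennreal (c^DIM('a)))"
    using lborel_affine[of c "0::'a"] c by simp
  show "(\<integral>x. f x \<partial>lborel) = c ^ DIM('a) * (\<integral>x. f (c *\<^sub>R x) \<partial>lborel)"
    by (subst eq) (use c in \<open>simp add: integral_density integral_distr\<close>)
  show "integrable lborel (\<lambda>x. f (c *\<^sub>R x)) \<longleftrightarrow> integrable lborel f"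
    by (subst (2) eq) (use c in \<open>simp add: integrable_density integrable_distr_eq\<close>)
qed

text \<open>Tonelli reduces the joint dilation to one scaling per variable. The factors are kept
  independent because both variables are dilated in \<open>e11_integral\<close> but only the second
  in \<open>Kdil_integral\<close>.\<close>

lemma lborel_pair_scaleR:
  assumes a: "a > 0" and c: "c > 0"
  shows "(lborel :: 'a::euclidean_space measure) \<Otimes>\<^sub>M (lborel :: 'b::euclidean_space measure) =
    density (distr (lborel \<Otimes>\<^sub>M lborel) (lborel \<Otimes>\<^sub>M lborel) (\<lambda>(\<xi>,x). (a *\<^sub>R \<xi>, c *\<^sub>R x)))
      (\<lambda>_. ennreal (a ^ DIM('a) * c ^ DIM('b)))"
    (is "?P = density ?D ?k")
proof (rule measure_eqI)
  show "sets ?P = sets (density ?D ?k)" by simp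
next
  fix A assume A[measurable]: "A \<in> sets ?P"
  have "emeasure ?P A = (\<integral>\<^sup>+\<xi>. \<integral>\<^sup>+x. indicator A (\<xi>, x) \<partial>lborel \<partial>lborel)"
    by (rule lborel.emeasure_pair_measure[OF A])
  also have "\<dots> = (\<integral>\<^sup>+\<xi>. ennreal (c ^ DIM('b)) * (\<integral>\<^sup>+x. indicator A (\<xi>, c *\<^sub>R x) \<partial>lborel) \<partial>lborel)"
    by (subst nn_integral_lborel_scaleR[OF _ c]) simp_all
  also have "\<dots> = ennreal (c ^ DIM('b)) * (\<integral>\<^sup>+\<xi>. (\<integral>\<^sup>+x. indicator A (\<xi>, c *\<^sub>R x) \<partial>lborel) \<partial>lborel)"
    by (subst nn_integral_cmult) simp_all
  also have "\<dots> = ennreal (c ^ DIM('b)) * (ennreal (a ^ DIM('a)) * (\<integral>\<^sup>+\<xi>. (\<integral>\<^sup>+x. indicator A (a *\<^sub>R \<xi>, c *\<^sub>R x) \<partial>lborel) \<partial>lborel))"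
    by (subst nn_integral_lborel_scaleR[OF _ a]) simp_all
  also have "\<dots> = ennreal (a ^ DIM('a) * c ^ DIM('b)) * (\<integral>\<^sup>+\<xi>. (\<integral>\<^sup>+x. indicator A (a *\<^sub>R \<xi>, c *\<^sub>R x) \<partial>lborel) \<partial>lborel)"
    using a c by (simp add: ennreal_mult ac_simps)
  also have "(\<integral>\<^sup>+\<xi>. (\<integral>\<^sup>+x. indicator A (a *\<^sub>R \<xi>, c *\<^sub>R x) \<partial>lborel) \<partial>lborel) =
     (\<integral>\<^sup>+z. indicator A (case z of (\<xi>,x) \<Rightarrow> (a *\<^sub>R \<xi>, c *\<^sub>R x)) \<partial>(lborel \<Otimes>\<^sub>M lborel))"
    by (subst lborel.nn_integral_fst[symmetric]) simp_all
  also have "ennreal (a ^ DIM('a) * c ^ DIM('b)) * \<dots> = emeasure (density ?D ?k) A"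
  proof -
    have T[measurable]: "(\<lambda>(\<xi>::'a,x::'b). (a *\<^sub>R \<xi>, c *\<^sub>R x)) \<in> lborel \<Otimes>\<^sub>M lborel \<rightarrow>\<^sub>M lborel \<Otimes>\<^sub>M lborel"
      by measurable
    have A': "A \<in> sets (density ?D ?k)" "A \<in> sets ?D" using A by simp_all
    have "emeasure (density ?D ?k) A = (\<integral>\<^sup>+z. ?k z * indicator A z \<partial>?D)"
      by (rule emeasure_density) (use A' in simp_all)
    also have "\<dots> = (\<integral>\<^sup>+z. ?k z * indicator A (case z of (\<xi>,x) \<Rightarrow> (a *\<^sub>R \<xi>, c *\<^sub>R x)) \<partial>(lborel \<Otimes>\<^sub>M lborel))"
      by (rule nn_integral_distr[OF T]) (use A in \<open>simp del: lborel_prod\<close>)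
    also have "\<dots> = ennreal (a ^ DIM('a) * c ^ DIM('b)) * (\<integral>\<^sup>+z. indicator A (case z of (\<xi>,x) \<Rightarrow> (a *\<^sub>R \<xi>, c *\<^sub>R x)) \<partial>(lborel \<Otimes>\<^sub>M lborel))"
      by (rule nn_integral_cmult) (use A in measurable)
    finally show ?thesis by simp
  qed
  finally show "emeasure ?P A = emeasure (density ?D ?k) A" .
qed

lemma integral_lborel_pair_scaleR:
  fixes F :: "'a::euclidean_space \<times> 'b::euclidean_space \<Rightarrow> real"
  assumes [measurable]: "F \<in> borel_measurable (lborel \<Otimes>\<^sub>M lborel)" and "a > 0" "c > 0"
  shows "integral\<^sup>L (lborel \<Otimes>\<^sub>M lborel) F =
      a ^ DIM('a) * c ^ DIM('b) * (\<integral>(\<xi>,x). F (a *\<^sub>R \<xi>, c *\<^sub>R x) \<partial>(lborel \<Otimes>\<^sub>M lborel))"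
    and "integrable (lborel \<Otimes>\<^sub>M lborel) (\<lambda>(\<xi>,x). F (a *\<^sub>R \<xi>, c *\<^sub>R x)) \<longleftrightarrow>
      integrable (lborel \<Otimes>\<^sub>M lborel) F"
proof -
  note eq = lborel_pair_scaleR[OF assms(2,3), where 'a='a and 'b='b]
  show "integral\<^sup>L (lborel \<Otimes>\<^sub>M lborel) F =
      a ^ DIM('a) * c ^ DIM('b) * (\<integral>(\<xi>,x). F (a *\<^sub>R \<xi>, c *\<^sub>R x) \<partial>(lborel \<Otimes>\<^sub>M lborel))"
    by (subst eq)
      (use assms in \<open>simp add: integral_density integral_distr del: lborel_prod; simp add: case_prod_unfold\<close>)
  show "integrable (lborel \<Otimes>\<^sub>M lborel) (\<lambda>(\<xi>,x). F (a *\<^sub>R \<xi>, c *\<^sub>R x)) \<longleftrightarrow>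
      integrable (lborel \<Otimes>\<^sub>M lborel) F"
    by (subst (2) eq)
      (use assms in \<open>simp add: integrable_density integrable_distr_eq del: lborel_prod; simp add: case_prod_unfold\<close>)
qed

section \<open>The logarithmic cutoff\<close>

lemma abs_exp_minus_one_le:
  fixes x :: real assumes "\<bar>x\<bar> \<le> X"
  shows "\<bar>exp x - 1\<bar> \<le> \<bar>x\<bar> * exp X"
proof (cases "x \<ge> 0")
  case True
  have "1 - x \<le> exp (-x)" using exp_ge_add_one_self[of "-x"] by simp
  then have "exp x * (1 - x) \<le> exp x * exp (-x)" by (intro mult_left_mono) auto
  then have "exp x - 1 \<le> x * exp x" by (simp add: algebra_simps exp_minus)
  also have "\<dots> \<le> x * exp X" using assms True by (intro mult_left_mono) auto
  finally show ?thesis using True by simp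
next
  case False
  have "1 - exp x \<le> -x" using exp_ge_add_one_self[of x] by linarith
  also have "\<dots> * 1 \<le> -x * exp X" using False assms by (intro mult_left_mono) auto
  finally show ?thesis using False by (simp add: abs_if)
qed

lemma abs_ln_le:
  fixes r :: real assumes "\<bar>r - 1\<bar> \<le> 1/2"
  shows "\<bar>ln r\<bar> \<le> 2 * \<bar>r - 1\<bar>"
proof -
  have r: "r \<ge> 1/2" using assms by (simp add: abs_if split: if_splits)
  have 1: "ln r \<le> r - 1" using r by (intro ln_le_minus_one) simp
  have "ln (1/r) \<le> 1/r - 1" using r by (intro ln_le_minus_one) simp
  then have 2: "- ln r \<le> (1 - r)/r" using r by (simp add: ln_div diff_divide_distrib)
  have "(1 - r)/r \<le> \<bar>r - 1\<bar>/r" using r by (intro divide_right_mono) auto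
  also have "\<dots> \<le> \<bar>r - 1\<bar>/(1/2)" using r by (intro divide_left_mono) auto
  finally have "(1 - r)/r \<le> 2 * \<bar>r - 1\<bar>" by simp
  with 2 have "- ln r \<le> 2 * \<bar>r - 1\<bar>" by (rule order_trans)
  moreover have "ln r \<le> 2 * \<bar>r - 1\<bar>"
  proof -
    have "r - 1 \<le> 2 * \<bar>r - 1\<bar>" by (smt (verit))
    with 1 show ?thesis by (rule order_trans)
  qed
  ultimately show ?thesis by (simp add: abs_le_iff)
qed

text \<open>For R > 0 this is 1 on 0 < r \<le> 1, vanishes for r \<ge> exp R, and is affine in ln r
  in between, so it varies by O(1/R) over any fixed range of scales. At r = 0 it depends on the
  default value of \<open>ln 0\<close>; the estimates below hold for any such value.\<close>

definition log_cutoff :: "real \<Rightarrow> real \<Rightarrow> real" where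
  "log_cutoff R r = max 0 (min 1 (1 - ln r / R))"

lemma log_cutoff_nonneg [simp]: "0 \<le> log_cutoff R r"
  and log_cutoff_le_1 [simp]: "log_cutoff R r \<le> 1"
  by (auto simp: log_cutoff_def)

lemma measurable_log_cutoff [measurable]: "log_cutoff R \<in> borel_measurable borel"
  unfolding log_cutoff_def [abs_def] by measurable

lemma abs_log_cutoff_diff_le_1: "\<bar>log_cutoff R r - log_cutoff R s\<bar> \<le> 1"
  using log_cutoff_nonneg[of R r] log_cutoff_nonneg[of R s] log_cutoff_le_1[of R r] log_cutoff_le_1[of R s]
  by linarith

text \<open>Truncation to [0, 1] does not increase distances, and the untruncated function is affine
  in the logarithm with slope -1/R.\<close>

lemma abs_log_cutoff_diff_le:
  assumes "R > 0"
  shows "\<bar>log_cutoff R r - log_cutoff R s\<bar> \<le> \<bar>ln r - ln s\<bar> / R"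
proof -
  have "\<bar>log_cutoff R r - log_cutoff R s\<bar> \<le> \<bar>ln r / R - ln s / R\<bar>"
    unfolding log_cutoff_def by (auto simp: max_def min_def)
  also have "\<dots> = \<bar>ln r - ln s\<bar> / R" using assms by (simp flip: diff_divide_distrib)
  finally show ?thesis .
qed

text \<open>A dilation shifts ln r by t. The resulting rate |t|/R is linear in t and vanishes as R
  grows, which is what every cutoff error has to satisfy.\<close>

lemma abs_log_cutoff_scale_le:
  assumes "R > 0" "r \<ge> 0"
  shows "\<bar>log_cutoff R (exp t * r) - log_cutoff R r\<bar> \<le> \<bar>t\<bar> / R"
proof (cases "r = 0")
  case False
  then show ?thesis using abs_log_cutoff_diff_le[OF assms(1), of "exp t * r" r] assms
    by (simp add: ln_mult)
qed (use assms in simp)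

text \<open>A displacement that is small relative to r moves ln r by at most twice the relative
  displacement. This is the gain available close to the diagonal of the kernel, with d the distance
  between the two points.\<close>

lemma abs_log_cutoff_diff_le_relative:
  assumes "R > 0" "r > 0" "\<bar>s - r\<bar> \<le> d" "d \<le> r / 2"
  shows "\<bar>log_cutoff R r - log_cutoff R s\<bar> \<le> 2 * d / r / R"
proof -
  have s: "s > 0" using assms by linarith
  have rel: "\<bar>s / r - 1\<bar> \<le> d / r"
  proof -
    have "\<bar>s / r - 1\<bar> = \<bar>s - r\<bar> / r" using assms by (simp add: abs_div_pos diff_divide_distrib)
    then show ?thesis using assms by (simp add: divide_right_mono)
  qed
  also have "d / r \<le> 1/2" using assms by (simp add: field_simps)
  finally have le: "\<bar>s / r - 1\<bar> \<le> 1/2" .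
  have "\<bar>ln (s / r)\<bar> \<le> 2 * \<bar>s / r - 1\<bar>" using le by (rule abs_ln_le)
  also have "\<dots> \<le> 2 * (d / r)" using rel by simp
  finally have "\<bar>ln r - ln s\<bar> \<le> 2 * d / r" using s assms by (simp add: ln_div abs_minus_commute)
  then show ?thesis using abs_log_cutoff_diff_le[OF assms(1), of r s] assms(1)
    by (meson divide_right_mono less_imp_le order_trans)
qed

lemma log_cutoff_nonzero_imp:
  assumes "R > 0" "r \<ge> 0" "log_cutoff R r \<noteq> 0"
  shows "r \<le> exp R"
proof (rule ccontr)
  assume "\<not> r \<le> exp R"
  then have "R \<le> ln r" by (metis assms(1) exp_gt_zero le_less_linear ln_exp ln_le_cancel_iff not_less_iff_gr_or_eq order.trans less_imp_le)
  then have "1 \<le> ln r / R" using assms by simp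
  then show False using assms by (simp add: log_cutoff_def)
qed

lemma log_cutoff_tendsto: "(\<lambda>k. log_cutoff (real (Suc k)) r) \<longlonglongrightarrow> 1"
proof -
  have "(\<lambda>k. max 0 (min 1 (1 - ln r * inverse (real (Suc k))))) \<longlonglongrightarrow> max 0 (min 1 (1 - ln r * 0))"
    by (intro tendsto_intros LIMSEQ_inverse_real_of_nat)
  then show ?thesis by (simp add: log_cutoff_def divide_inverse)
qed

text \<open>Young's inequality with conjugate exponents (p+1)/p and p+1, whose reciprocals are the
  two weights. The case of a vanishing factor is split off because the real powers are
  inverted.\<close>

lemma powr_mult_le_weighted:
  fixes a b p :: real
  assumes "a \<ge> 0" "b \<ge> 0" "p > 0"
  shows "a powr p * b \<le> p / (p+1) * a powr (p+1) + 1 / (p+1) * b powr (p+1)"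
proof (cases "a = 0 \<or> b = 0")
  case False
  then have "(a powr (p+1)) powr (p/(p+1)) * (b powr (p+1)) powr (1/(p+1))
     \<le> p/(p+1) * a powr (p+1) + 1/(p+1) * b powr (p+1)"
    using assms by (intro Youngs_inequality_0) (auto simp: field_simps)
  then show ?thesis using assms False by (simp add: powr_powr)
qed (use assms in auto)

section \<open>The half-space kernel\<close>

text \<open>The indicator extends the kernel by zero, so all integrals run over the whole space.
  Writing the denominator as a power of the distance to the boundary point makes homogeneity and the
  effect of moving x directly visible.\<close>

definition half_space_kernel :: "real \<Rightarrow> real^'m \<Rightarrow> (real^'m) \<times> real \<Rightarrow> real" where
  "half_space_kernel \<sigma> \<xi> x = indicator upper_half x * (snd x * dist x (\<xi>, 0) powr (-\<sigma>))"

lemma half_space_kernel_nonneg: "half_space_kernel \<sigma> \<xi> x \<ge> 0"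
  by (auto simp: half_space_kernel_def upper_half_def indicator_def)

text \<open>The norm on pairs is Euclidean, so the denominator is the squared distance to (\<xi>, 0)
  raised to half of the exponent.\<close>

lemma Pker_eq_half_space_kernel:
  fixes \<xi> :: "real^'m"
  shows "indicator upper_half x * Pker x \<xi> \<gamma> = half_space_kernel (real (CARD('m) + 1) + 2 - \<gamma>) \<xi> x"
proof (cases "x \<in> upper_half")
  case True
  define d where "d = dist x (\<xi>, 0)"
  have d: "(norm (fst x - \<xi>))\<^sup>2 + (snd x)\<^sup>2 = d\<^sup>2"
    by (simp add: d_def dist_prod_def dist_norm)
  have "d > 0" using True by (auto simp: d_def upper_half_def)
  then have "(d\<^sup>2) powr (s / 2) = d powr s" for s by (simp add: powr_powr flip: powr_numeral)
  then show ?thesis using True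
    unfolding Pker_def half_space_kernel_def d d_def[symmetric]
    by (simp only: powr_minus_divide indicator_simps) simp
qed (simp add: half_space_kernel_def)

lemma upper_half_scaleR_iff: "c > 0 \<Longrightarrow> c *\<^sub>R x \<in> upper_half \<longleftrightarrow> x \<in> upper_half"
  by (auto simp: upper_half_def zero_less_mult_iff)

text \<open>The height contributes degree 1 and the distance degree -\<sigma>.\<close>

lemma half_space_kernel_scaleR:
  assumes "c > 0"
  shows "half_space_kernel \<sigma> (c *\<^sub>R \<xi>) (c *\<^sub>R x) = c powr (1 - \<sigma>) * half_space_kernel \<sigma> \<xi> x"
proof -
  have "(c *\<^sub>R \<xi>, 0::real) = c *\<^sub>R (\<xi>, 0)" by simp
  then have "dist (c *\<^sub>R x) (c *\<^sub>R \<xi>, 0) = c * dist x (\<xi>, 0)"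
    using assms by (simp only: dist_norm norm_scaleR abs_of_pos flip: scaleR_diff_right)
  moreover have "c * c powr -\<sigma> = c powr (1 - \<sigma>)"
    using assms by (simp add: powr_diff powr_minus_divide)
  ultimately show ?thesis using assms
    by (simp add: half_space_kernel_def upper_half_scaleR_iff indicator_def powr_mult)
qed

text \<open>Near the diagonal a dilation of one variable alone may change the kernel by an unbounded
  factor. The slowly varying cutoff difference compensates this.\<close>

lemma half_space_kernel_dilation_diff:
  fixes y :: "(real^'m) \<times> real" and \<xi> :: "real^'m" and R c \<sigma> t :: real
  assumes R: "R \<ge> 1" and \<sigma>: "\<sigma> \<ge> 0" and t: "\<bar>t\<bar> \<le> 1/8"
  defines "k \<equiv> half_space_kernel \<sigma> \<xi> y"
    and "kt \<equiv> exp (-c*t) * half_space_kernel \<sigma> \<xi> (exp (-t) *\<^sub>R y)"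
    and "A \<equiv> (1 + norm y / dist y (\<xi>, 0)) * \<bar>log_cutoff R (norm y) - log_cutoff R (norm \<xi>)\<bar>"
    and "C \<equiv> (\<bar>c\<bar> + 1 + 4 * \<sigma>) * exp (\<bar>c\<bar> + 1 + \<sigma>)"
  shows "\<bar>kt * (log_cutoff R (norm (exp (-t) *\<^sub>R y)) - log_cutoff R (norm \<xi>))
      - k * (log_cutoff R (norm y) - log_cutoff R (norm \<xi>))\<bar>
    \<le> \<bar>t\<bar> * (9 / R * (kt + k) + C * A * k)"
proof (cases "y \<in> upper_half")
  case False
  then show ?thesis
    by (simp add: k_def kt_def half_space_kernel_def upper_half_scaleR_iff)
next
  case True
  then have y: "snd y > 0" by (simp add: upper_half_def)
  then have ny: "norm y > 0" by auto
  define d where "d = dist y (\<xi>, 0)"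
  have d: "d > 0" using y by (auto simp: d_def)
  define dz where "dz = dist (exp (-t) *\<^sub>R y) (\<xi>, 0)"
  have "snd (exp (-t) *\<^sub>R y) > 0" using y by simp
  then have dz: "dz > 0" unfolding dz_def by (metis less_irrefl snd_conv zero_less_dist_iff)
  define \<phi>y where "\<phi>y = log_cutoff R (norm y)"
  define \<phi>\<xi> where "\<phi>\<xi> = log_cutoff R (norm \<xi>)"
  define \<phi>z where "\<phi>z = log_cutoff R (norm (exp (-t) *\<^sub>R y))"
  have k0: "k \<ge> 0" and kt0: "kt \<ge> 0" by (auto simp: k_def kt_def half_space_kernel_nonneg)
  have A0: "A \<ge> 0" by (simp add: A_def)
  have C0: "C \<ge> 0" using \<sigma> by (simp add: C_def)
  have et: "\<bar>exp (-t) - 1\<bar> \<le> 2 * \<bar>t\<bar>"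
  proof -
    have "\<bar>exp (-t) - 1\<bar> \<le> \<bar>-t\<bar> * exp (1/2)" using t by (intro abs_exp_minus_one_le) simp
    also have "\<dots> \<le> \<bar>t\<bar> * 2"
      using exp_bound_half[of "1/2::real"] by (intro mult_mono) auto
    finally show ?thesis by simp
  qed
  have ddz: "\<bar>dz - d\<bar> \<le> 2 * \<bar>t\<bar> * norm y"
  proof -
    have "\<bar>dz - d\<bar> \<le> dist (exp (-t) *\<^sub>R y) y"
      unfolding d_def dz_def dist_commute[of y "(\<xi>, 0)"] by (rule abs_dist_diff_le)
    also have "\<dots> = \<bar>exp (-t) - 1\<bar> * norm y"
      by (simp add: dist_norm flip: norm_scaleR) (simp add: scaleR_left_diff_distrib)
    also have "\<dots> \<le> 2 * \<bar>t\<bar> * norm y" using et by (intro mult_right_mono) auto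
    finally show ?thesis .
  qed
  have \<phi>z: "\<bar>\<phi>z - \<phi>y\<bar> \<le> \<bar>t\<bar> / R"
    using abs_log_cutoff_scale_le[of R "norm y" "-t"] R by (simp add: \<phi>z_def \<phi>y_def)
  \<comment> \<open>Two regimes. If the dilation moves y by little compared with d, the two kernels
    are comparable and their difference is estimated. Otherwise y is so close to \<xi>, relative to
    its norm, that the cutoff difference alone is O(|t|/R), and the kernels need no
    comparison.\<close>
  have second: "\<bar>(kt - k) * (\<phi>y - \<phi>\<xi>)\<bar> \<le> \<bar>t\<bar> * (8 / R * (kt + k) + C * A * k)"
  proof (cases "2 * \<bar>t\<bar> * norm y \<le> d / 2")
    case True
    define r where "r = dz / d"
    have r: "r > 0" using d dz by (simp add: r_def)
    have "\<bar>r - 1\<bar> = \<bar>dz - d\<bar> / d" using d by (simp add: r_def abs_div_pos diff_divide_distrib)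
    also have "\<dots> \<le> 2 * \<bar>t\<bar> * norm y / d" using ddz d by (intro divide_right_mono) auto
    finally have r1: "\<bar>r - 1\<bar> \<le> 2 * \<bar>t\<bar> * norm y / d" .
    also have "\<dots> \<le> 1/2" using True d by (simp add: field_simps)
    finally have r2: "\<bar>r - 1\<bar> \<le> 1/2" .
    have lnr: "\<bar>ln r\<bar> \<le> 4 * \<bar>t\<bar> * (norm y / d)" "\<bar>ln r\<bar> \<le> 1"
      using abs_ln_le[OF r2] r1 r2 by auto
    \<comment> \<open>x is the logarithm of kt / k: the prefactor contributes -ct, the height -t,
      and the distance -\<sigma> ln r.\<close>
    define x where "x = - ((c + 1) * t + \<sigma> * ln r)"
    have x1: "\<bar>x\<bar> \<le> (\<bar>c\<bar> + 1) * \<bar>t\<bar> + \<sigma> * \<bar>ln r\<bar>"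
    proof -
      have "\<bar>x\<bar> \<le> \<bar>(c + 1) * t\<bar> + \<bar>\<sigma> * ln r\<bar>"
        unfolding x_def abs_minus_cancel by (rule abs_triangle_ineq)
      also have "\<dots> = \<bar>c + 1\<bar> * \<bar>t\<bar> + \<sigma> * \<bar>ln r\<bar>" using \<sigma> by (simp add: abs_mult)
      also have "\<dots> \<le> (\<bar>c\<bar> + 1) * \<bar>t\<bar> + \<sigma> * \<bar>ln r\<bar>" by (intro add_right_mono mult_right_mono) auto
      finally show ?thesis .
    qed
    have "\<bar>x\<bar> \<le> (\<bar>c\<bar> + 1) * 1 + \<sigma> * 1"
      by (rule order_trans[OF x1]) (use t lnr \<sigma> in \<open>intro add_mono mult_left_mono; simp\<close>)
    then have x2: "\<bar>x\<bar> \<le> \<bar>c\<bar> + 1 + \<sigma>" by simp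
    have "\<bar>x\<bar> \<le> (\<bar>c\<bar> + 1) * \<bar>t\<bar> + \<sigma> * (4 * \<bar>t\<bar> * (norm y / d))"
      by (rule order_trans[OF x1]) (use lnr \<sigma> in \<open>intro add_mono mult_left_mono; simp\<close>)
    also have "\<dots> \<le> (\<bar>c\<bar> + 1 + 4 * \<sigma>) * \<bar>t\<bar> * (1 + norm y / d)"
    proof -
      have "0 \<le> (\<bar>c\<bar> + 1) * \<bar>t\<bar> * (norm y / d) + 4 * \<sigma> * \<bar>t\<bar>" using \<sigma> d by auto
      then show ?thesis by (simp add: algebra_simps)
    qed
    finally have x3: "\<bar>x\<bar> \<le> (\<bar>c\<bar> + 1 + 4 * \<sigma>) * \<bar>t\<bar> * (1 + norm y / d)" .
    have kt: "kt = exp x * k"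
    proof -
      have "dz powr (-\<sigma>) = exp (-\<sigma> * ln r) * d powr (-\<sigma>)"
        using d dz by (simp add: r_def powr_def ln_div algebra_simps flip: exp_add)
      moreover have "exp x = exp (-c*t) * exp (-t) * exp (-\<sigma> * ln r)"
        by (simp add: x_def algebra_simps flip: exp_add)
      ultimately show ?thesis using \<open>y \<in> upper_half\<close>
        by (simp add: kt_def k_def half_space_kernel_def upper_half_scaleR_iff d_def[symmetric] dz_def[symmetric])
    qed
    have "\<bar>kt - k\<bar> = \<bar>exp x - 1\<bar> * k"
    proof -
      have "kt - k = (exp x - 1) * k" by (simp add: kt algebra_simps)
      then show ?thesis using k0 by (simp add: abs_mult)
    qed
    also have "\<dots> \<le> (\<bar>x\<bar> * exp (\<bar>c\<bar> + 1 + \<sigma>)) * k"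
      using k0 x2 by (intro mult_right_mono abs_exp_minus_one_le) auto
    also have "\<dots> \<le> ((\<bar>c\<bar> + 1 + 4 * \<sigma>) * \<bar>t\<bar> * (1 + norm y / d) * exp (\<bar>c\<bar> + 1 + \<sigma>)) * k"
      using k0 x3 by (intro mult_right_mono) auto
    also have "\<dots> = \<bar>t\<bar> * C * (1 + norm y / d) * k" by (simp add: C_def)
    finally have "\<bar>kt - k\<bar> * \<bar>\<phi>y - \<phi>\<xi>\<bar> \<le> \<bar>t\<bar> * C * (1 + norm y / d) * k * \<bar>\<phi>y - \<phi>\<xi>\<bar>"
      by (rule mult_right_mono) simp
    also have "\<dots> = \<bar>t\<bar> * (C * A * k)" by (simp add: A_def \<phi>y_def \<phi>\<xi>_def d_def)
    also have "\<dots> \<le> \<bar>t\<bar> * (8 / R * (kt + k) + C * A * k)"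
      using k0 kt0 R by (intro mult_left_mono) auto
    finally show ?thesis by (simp add: abs_mult)
  next
    case False
    \<comment> \<open>The bound |t| \<le> 1/8 turns this into d \<le> |y|/2, the range in which the
      relative cutoff estimate applies.\<close>
    then have dt: "d \<le> 4 * \<bar>t\<bar> * norm y" by simp
    also have "\<dots> \<le> 4 * (1/8) * norm y" using t by (intro mult_right_mono mult_left_mono) auto
    finally have "d \<le> norm y / 2" by simp
    moreover have "\<bar>norm \<xi> - norm y\<bar> \<le> d"
      unfolding d_def dist_norm using norm_triangle_ineq3[of y "(\<xi>, 0)"] by (simp add: norm_Pair abs_minus_commute)
    ultimately have "\<bar>\<phi>y - \<phi>\<xi>\<bar> \<le> 2 * d / norm y / R"
      unfolding \<phi>y_def \<phi>\<xi>_def using R ny by (intro abs_log_cutoff_diff_le_relative) auto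
    also have "\<dots> \<le> 2 * (4 * \<bar>t\<bar> * norm y) / norm y / R"
      using dt R by (intro divide_right_mono mult_left_mono) auto
    also have "\<dots> = 8 * \<bar>t\<bar> / R" using ny by simp
    finally have 1: "\<bar>\<phi>y - \<phi>\<xi>\<bar> \<le> 8 * \<bar>t\<bar> / R" .
    have "\<bar>kt - k\<bar> * \<bar>\<phi>y - \<phi>\<xi>\<bar> \<le> (kt + k) * (8 * \<bar>t\<bar> / R)"
      using 1 k0 kt0 by (intro mult_mono) auto
    also have "\<dots> = \<bar>t\<bar> * (8 / R * (kt + k))" by simp
    also have "\<dots> \<le> \<bar>t\<bar> * (8 / R * (kt + k) + C * A * k)"
      using k0 A0 C0 by (intro mult_left_mono) auto
    finally show ?thesis by (simp add: abs_mult)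
  qed
  \<comment> \<open>The change of the cutoff along the dilation costs |t|/R and
    \<open>second\<close> costs 8|t|/R on the kernels, whence the constant 9.\<close>
  have "\<bar>kt * (\<phi>z - \<phi>\<xi>) - k * (\<phi>y - \<phi>\<xi>)\<bar> = \<bar>kt * (\<phi>z - \<phi>y) + (kt - k) * (\<phi>y - \<phi>\<xi>)\<bar>"
    by (simp add: algebra_simps)
  also have "\<dots> \<le> \<bar>kt * (\<phi>z - \<phi>y)\<bar> + \<bar>(kt - k) * (\<phi>y - \<phi>\<xi>)\<bar>" by (rule abs_triangle_ineq)
  also have "\<bar>kt * (\<phi>z - \<phi>y)\<bar> \<le> (kt + k) * (\<bar>t\<bar> / R)"
    unfolding abs_mult using k0 kt0 \<phi>z by (intro mult_mono) auto
  also note second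
  also have "(kt + k) * (\<bar>t\<bar> / R) + \<bar>t\<bar> * (8 / R * (kt + k) + C * A * k) = \<bar>t\<bar> * (9 / R * (kt + k) + C * A * k)"
    using R by (simp add: field_simps)
  finally show ?thesis by (simp add: \<phi>z_def \<phi>y_def \<phi>\<xi>_def)
qed

text \<open>The factor |y|/d is large only for d \<le> |y|/2, where the cutoff difference is at most
  2d/|y|; elsewhere it is at most 2. A bound uniform in R provides the dominating function when R
  tends to infinity.\<close>

lemma relative_cutoff_bound:
  fixes y :: "(real^'m) \<times> real" and \<xi> :: "real^'m"
  assumes R: "R \<ge> 1"
  shows "(1 + norm y / dist y (\<xi>, 0)) * \<bar>log_cutoff R (norm y) - log_cutoff R (norm \<xi>)\<bar> \<le> 3"
proof -
  define d where "d = dist y (\<xi>, 0)"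
  define D where "D = \<bar>log_cutoff R (norm y) - log_cutoff R (norm \<xi>)\<bar>"
  have D1: "D \<le> 1" "D \<ge> 0" unfolding D_def by (simp_all add: abs_log_cutoff_diff_le_1)
  show ?thesis
  proof (cases "d = 0 \<or> y = 0")
    \<comment> \<open>Here the quotient is 0, for d = 0 because division by zero yields 0.\<close>
    case True
    then show ?thesis using D1 unfolding d_def[symmetric] D_def[symmetric] by auto
  next
    case False
    then have d: "d > 0" and ny: "norm y > 0" by (auto simp: d_def)
    have "norm y / d * D \<le> 2"
    proof (cases "d \<le> norm y / 2")
      case True
      moreover have "\<bar>norm \<xi> - norm y\<bar> \<le> d"
        unfolding d_def dist_norm using norm_triangle_ineq3[of y "(\<xi>, 0)"] by (simp add: norm_Pair abs_minus_commute)
      ultimately have "D \<le> 2 * d / norm y / R"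
        unfolding D_def using R ny by (intro abs_log_cutoff_diff_le_relative) auto
      also have "\<dots> \<le> 2 * d / norm y / 1" using R d ny by (intro divide_left_mono) auto
      finally have "norm y / d * D \<le> norm y / d * (2 * d / norm y)"
        using d by (intro mult_left_mono) auto
      then show ?thesis using d ny by simp
    next
      case False
      then have "norm y / d \<le> 2" using d by (simp add: field_simps)
      then have "norm y / d * D \<le> 2 * 1" using D1 d by (intro mult_mono) auto
      then show ?thesis by simp
    qed
    then show ?thesis using D1 unfolding d_def[symmetric] D_def[symmetric] by (simp add: distrib_right)
  qed
qed

section \<open>Dilations of weighted powers\<close>

text \<open>Instantiated once for u on the boundary and once for v. The weight may vanish, so that
  the half space is encoded by a weight equal to zero outside it; \<open>w_hom\<close> says that the
  weight is homogeneous of degree -\<alpha>.\<close>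

locale weighted_power =
  fixes w u :: "'a::euclidean_space \<Rightarrow> real" and p \<alpha> :: real
  assumes p_pos: "p > 0"
    and w_meas [measurable]: "w \<in> borel_measurable borel"
    and u_meas [measurable]: "u \<in> borel_measurable borel"
    and w_nonneg: "w x \<ge> 0" and u_nonneg: "u x \<ge> 0"
    and w_hom: "w (exp t *\<^sub>R x) = exp (-\<alpha> * t) * w x"
    and fin: "integrable lborel (\<lambda>x. w x * u x powr (p + 1))"
begin

definition dens :: "'a \<Rightarrow> real" where
  "dens x = w x * u x powr p"

text \<open>The exponent makes the weighted \<open>L\<^sup>p\<^sup>+\<^sup>1\<close> norm of the underlying dilate of \<open>u\<close> independent of \<open>t\<close>.\<close>

definition dens_dil :: "real \<Rightarrow> 'a \<Rightarrow> real" where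
  "dens_dil t x = exp ((DIM('a) - (DIM('a) - \<alpha>) / (p + 1)) * t) * dens (exp t *\<^sub>R x)"

definition pdens :: "'a \<Rightarrow> real" where
  "pdens x = w x * u x powr (p + 1)"

definition pdens_dil :: "real \<Rightarrow> 'a \<Rightarrow> real" where
  "pdens_dil t x = exp (real DIM('a) * t) * pdens (exp t *\<^sub>R x)"

lemma measurable_dens [measurable]:
  "dens \<in> borel_measurable borel" "dens_dil t \<in> borel_measurable borel"
  "pdens \<in> borel_measurable borel" "pdens_dil t \<in> borel_measurable borel"
  unfolding dens_def[abs_def] dens_dil_def[abs_def] pdens_def[abs_def] pdens_dil_def[abs_def]
  by measurable

lemma dens_nonneg: "dens x \<ge> 0" "dens_dil t x \<ge> 0" "pdens x \<ge> 0" "pdens_dil t x \<ge> 0"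
  by (auto simp: dens_def dens_dil_def pdens_def pdens_dil_def w_nonneg)

lemma dens_mult_eq: "dens x * u x = pdens x"
  using u_nonneg[of x] p_pos by (cases "u x = 0") (auto simp: dens_def pdens_def powr_add)

lemma integrable_pdens: "integrable lborel pdens"
  using fin by (simp add: pdens_def[abs_def])

lemma dens_dil_mult_le:
  "dens_dil t x * u x \<le> p / (p + 1) * pdens_dil t x + 1 / (p + 1) * pdens x"
proof -
  \<comment> \<open>a is the norm-preserving dilate of u at x. By homogeneity of the weight, w a^p
    is \<open>dens_dil\<close> and w a^(p+1) is \<open>pdens_dil\<close>, so Young's inequality for
    a and u x gives the claim after multiplication by w.\<close>
  define a where "a = exp ((DIM('a) - \<alpha>) / (p + 1) * t) * u (exp t *\<^sub>R x)"
  have a0: "a \<ge> 0" using u_nonneg by (simp add: a_def)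
  have apow: "a powr s = exp ((DIM('a) - \<alpha>) / (p + 1) * t * s) * u (exp t *\<^sub>R x) powr s" for s
    using u_nonneg by (simp add: a_def powr_mult exp_powr_real)
  have "w x * a powr p = exp ((DIM('a) - \<alpha>) / (p + 1) * t * p) * (w x * u (exp t *\<^sub>R x) powr p)"
    unfolding apow by simp
  also have "(DIM('a) - \<alpha>) / (p + 1) * t * p = (DIM('a) - (DIM('a) - \<alpha>) / (p + 1)) * t + (- \<alpha> * t)"
    using p_pos by (simp add: field_simps)
  finally have 1: "w x * a powr p = dens_dil t x"
    unfolding dens_dil_def dens_def w_hom exp_add by simp
  have "w x * a powr (p+1) = exp ((DIM('a) - \<alpha>) / (p + 1) * t * (p+1)) * (w x * u (exp t *\<^sub>R x) powr (p+1))"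
    unfolding apow by simp
  also have "(DIM('a) - \<alpha>) / (p + 1) * t * (p+1) = real DIM('a) * t + (- \<alpha> * t)"
    using p_pos by (simp add: field_simps)
  finally have 2: "w x * a powr (p+1) = pdens_dil t x"
    unfolding pdens_dil_def pdens_def w_hom exp_add by simp
  have "w x * (a powr p * u x) \<le> w x * (p / (p+1) * a powr (p+1) + 1 / (p+1) * u x powr (p+1))"
    by (intro mult_left_mono powr_mult_le_weighted a0 u_nonneg p_pos w_nonneg)
  also have "\<dots> = p / (p + 1) * (w x * a powr (p+1)) + 1 / (p + 1) * (w x * u x powr (p+1))"
    by (simp add: algebra_simps)
  finally show ?thesis unfolding 2 by (simp add: 1[symmetric] pdens_def mult.assoc)
qed

lemma integrable_pdens_dil: "integrable lborel (pdens_dil t)"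
  using integral_lborel_scaleR(2)[of pdens "exp t"] integrable_pdens
  by (simp add: pdens_dil_def[abs_def])

text \<open>The prefactor of \<open>pdens_dil\<close> is the Jacobian, so a change of variables
  moves the dilation onto the test function.\<close>

lemma integral_pdens_dil:
  assumes [measurable]: "\<psi> \<in> borel_measurable borel"
  shows "(\<integral>x. \<psi> x * pdens_dil t x \<partial>lborel) = (\<integral>x. \<psi> (exp (-t) *\<^sub>R x) * pdens x \<partial>lborel)"
proof -
  have "(\<integral>x. \<psi> (exp (-t) *\<^sub>R x) * pdens x \<partial>lborel) =
      exp t ^ DIM('a) * (\<integral>x. \<psi> x * pdens (exp t *\<^sub>R x) \<partial>lborel)"
    by (subst integral_lborel_scaleR(1)[of _ "exp t"]) (simp_all flip: exp_add)
  also have "\<dots> = (\<integral>x. \<psi> x * pdens_dil t x \<partial>lborel)"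
    unfolding pdens_dil_def
    by (subst integral_mult_right_zero[symmetric]) (simp add: exp_of_nat_mult mult.left_commute)
  finally show ?thesis ..
qed

lemma integrable_dens_dil_mult: "integrable lborel (\<lambda>x. dens_dil t x * u x)"
proof (rule Bochner_Integration.integrable_bound)
  show "integrable lborel (\<lambda>x. p / (p + 1) * pdens_dil t x + 1 / (p + 1) * pdens x)"
    by (intro integrable_pdens integrable_pdens_dil Bochner_Integration.integrable_add integrable_mult_right)
  show "AE x in lborel. norm (dens_dil t x * u x)
      \<le> norm (p / (p + 1) * pdens_dil t x + 1 / (p + 1) * pdens x)"
    using dens_dil_mult_le dens_nonneg u_nonneg p_pos by (intro always_eventually allI) (simp add: abs_of_nonneg)
qed simp

text \<open>The dilation preserves the mass of \<open>pdens\<close> and the Young weights add up to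
  1.\<close>

lemma integral_dens_dil_mult_le: "(\<integral>x. dens_dil t x * u x \<partial>lborel) \<le> (\<integral>x. pdens x \<partial>lborel)"
proof -
  have "(\<integral>x. dens_dil t x * u x \<partial>lborel) \<le> (\<integral>x. p / (p + 1) * pdens_dil t x + 1 / (p + 1) * pdens x \<partial>lborel)"
    by (intro integral_mono integrable_dens_dil_mult integrable_pdens integrable_pdens_dil
        Bochner_Integration.integrable_add integrable_mult_right dens_dil_mult_le)
  also have "\<dots> = p / (p + 1) * (\<integral>x. pdens_dil t x \<partial>lborel) + 1 / (p + 1) * (\<integral>x. pdens x \<partial>lborel)"
    using integrable_pdens integrable_pdens_dil by simp
  also have "(\<integral>x. pdens_dil t x \<partial>lborel) = (\<integral>x. pdens x \<partial>lborel)"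
    using integral_pdens_dil[of "\<lambda>_. 1" t] by simp
  also have "p / (p + 1) * (\<integral>x. pdens x \<partial>lborel) + 1 / (p + 1) * (\<integral>x. pdens x \<partial>lborel) = (\<integral>x. pdens x \<partial>lborel)"
    using p_pos unfolding distrib_right[symmetric] by (simp add: add_divide_distrib[symmetric])
  finally show ?thesis .
qed

lemma integrable_bounded_mult_pdens:
  assumes [measurable]: "\<psi> \<in> borel_measurable borel" and "\<And>x. \<bar>\<psi> x\<bar> \<le> 1"
  shows "integrable lborel (\<lambda>x. \<psi> x * pdens x)" "integrable lborel (\<lambda>x. \<psi> x * pdens_dil t x)"
    "integrable lborel (\<lambda>x. \<psi> x * (dens_dil t x * u x))"
  by (rule Bochner_Integration.integrable_bound, rule integrable_pdens integrable_pdens_dil integrable_dens_dil_mult,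
      use assms in \<open>auto simp: abs_mult dens_nonneg u_nonneg intro!: mult_left_le_one_le AE_I2\<close>)+

text \<open>Young's inequality is an equality at t = 0, so subtracting it leaves a multiple of
  \<open>pdens_dil\<close> minus \<open>pdens\<close>. With the cutoff present this difference no
  longer integrates to zero, but moving the dilation onto the cutoff leaves only its
  variation.\<close>

lemma cutoff_dilation_le:
  assumes R: "R > 0"
  shows "(\<integral>x. log_cutoff R (norm x) * ((dens_dil t x - dens x) * u x) \<partial>lborel)
    \<le> \<bar>t\<bar> / R * (\<integral>x. pdens x \<partial>lborel)"
proof -
  define \<phi> where "\<phi> x = log_cutoff R (norm x)" for x :: 'a
  have [measurable]: "\<phi> \<in> borel_measurable borel" unfolding \<phi>_def[abs_def] by measurable
  have \<phi>: "\<bar>\<phi> x\<bar> \<le> 1" "\<phi> x \<ge> 0" for x by (simp_all add: \<phi>_def)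
  have \<phi>': "\<bar>\<phi> (exp (-t) *\<^sub>R x)\<bar> \<le> 1" for x by (rule \<phi>)
  note ints = integrable_bounded_mult_pdens[of \<phi>, OF _ \<phi>(1)]
    integrable_bounded_mult_pdens(1)[of "\<lambda>x. \<phi> (exp (-t) *\<^sub>R x)", OF _ \<phi>']
  have "(\<integral>x. \<phi> x * ((dens_dil t x - dens x) * u x) \<partial>lborel)
      \<le> (\<integral>x. p / (p + 1) * (\<phi> x * pdens_dil t x - \<phi> x * pdens x) \<partial>lborel)"
  proof (rule integral_mono)
    show "integrable lborel (\<lambda>x. \<phi> x * ((dens_dil t x - dens x) * u x))"
      using ints by (simp add: left_diff_distrib dens_mult_eq right_diff_distrib)
    show "integrable lborel (\<lambda>x. p / (p + 1) * (\<phi> x * pdens_dil t x - \<phi> x * pdens x))"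
      using ints by simp
    fix x
    have "(dens_dil t x - dens x) * u x \<le> p / (p + 1) * (pdens_dil t x - pdens x)"
    proof -
      have "1 / (p + 1) = 1 - p / (p + 1)" using p_pos by (simp add: field_simps)
      then have "p / (p + 1) * pdens_dil t x + 1 / (p + 1) * pdens x - pdens x = p / (p + 1) * (pdens_dil t x - pdens x)"
        by (simp only: left_diff_distrib right_diff_distrib)
      then show ?thesis using dens_dil_mult_le[of t x] by (simp add: left_diff_distrib dens_mult_eq)
    qed
    from mult_left_mono[OF this \<phi>(2)[of x]]
    show "\<phi> x * ((dens_dil t x - dens x) * u x) \<le> p / (p + 1) * (\<phi> x * pdens_dil t x - \<phi> x * pdens x)"
      by (simp add: algebra_simps)
  qed
  also have "\<dots> = p / (p + 1) * ((\<integral>x. \<phi> (exp (-t) *\<^sub>R x) * pdens x \<partial>lborel) - (\<integral>x. \<phi> x * pdens x \<partial>lborel))"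
    using ints by (simp add: integral_pdens_dil)
  also have "(\<integral>x. \<phi> (exp (-t) *\<^sub>R x) * pdens x \<partial>lborel) - (\<integral>x. \<phi> x * pdens x \<partial>lborel)
      = (\<integral>x. \<phi> (exp (-t) *\<^sub>R x) * pdens x - \<phi> x * pdens x \<partial>lborel)"
    using ints by simp
  also have "p / (p + 1) * \<dots> \<le> p / (p + 1) * (\<integral>x. \<bar>t\<bar> / R * pdens x \<partial>lborel)"
  proof (rule mult_left_mono)
    show "(\<integral>x. \<phi> (exp (-t) *\<^sub>R x) * pdens x - \<phi> x * pdens x \<partial>lborel) \<le> (\<integral>x. \<bar>t\<bar> / R * pdens x \<partial>lborel)"
    proof (rule integral_mono)
      fix x
      have "\<phi> (exp (-t) *\<^sub>R x) - \<phi> x \<le> \<bar>t\<bar> / R"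
        using abs_log_cutoff_scale_le[OF R, of "norm x" "-t"] by (simp add: \<phi>_def)
      from mult_right_mono[OF this dens_nonneg(3)[of x]]
      show "\<phi> (exp (-t) *\<^sub>R x) * pdens x - \<phi> x * pdens x \<le> \<bar>t\<bar> / R * pdens x"
        by (simp add: left_diff_distrib)
    qed (use ints integrable_pdens in simp_all)
  qed (use p_pos in simp)
  also have "\<dots> = p / (p + 1) * (\<bar>t\<bar> / R * (\<integral>x. pdens x \<partial>lborel))" by simp
  also have "\<dots> \<le> 1 * (\<bar>t\<bar> / R * (\<integral>x. pdens x \<partial>lborel))"
    using p_pos R by (intro mult_right_mono mult_nonneg_nonneg Bochner_Integration.integral_nonneg dens_nonneg) auto
  finally show ?thesis by (simp add: \<phi>_def)
qed

text \<open>The dilates of u need have no common integrable majorant, so dominated convergence is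
  not directly available. The majorants \<open>pdens_dil\<close> themselves converge in L^1, since
  they converge pointwise and have equal mass, and this suffices.\<close>

lemma integral_dens_dil_diff_tendsto:
  assumes cont: "\<And>x. w x \<noteq> 0 \<Longrightarrow> ((\<lambda>t. u (exp t *\<^sub>R x)) \<longlongrightarrow> u x) (at 0)"
    and u_pos: "\<And>x. w x \<noteq> 0 \<Longrightarrow> u x > 0"
    and s: "s \<longlonglongrightarrow> 0" "\<And>k. s k \<noteq> (0::real)"
  shows "(\<lambda>k. \<integral>x. \<bar>dens_dil (s k) x - dens x\<bar> * u x \<partial>lborel) \<longlonglongrightarrow> 0"
proof -
  define F where "F k x = \<bar>dens_dil (s k) x - dens x\<bar> * u x" for k x
  have F_meas [measurable]: "F k \<in> borel_measurable borel" for k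
    unfolding F_def[abs_def] by measurable
  have F0: "F k x \<ge> 0" for k x by (simp add: F_def u_nonneg)
  have Fint: "integrable lborel (F k)" for k
  proof (rule Bochner_Integration.integrable_bound)
    show "integrable lborel (\<lambda>x. dens_dil (s k) x * u x + pdens x)"
      by (intro Bochner_Integration.integrable_add integrable_dens_dil_mult integrable_pdens)
    show "AE x in lborel. norm (F k x) \<le> norm (dens_dil (s k) x * u x + pdens x)"
    proof (intro AE_I2)
      fix x
      have "\<bar>dens_dil (s k) x - dens x\<bar> \<le> dens_dil (s k) x + dens x"
        using dens_nonneg(1)[of x] dens_nonneg(2)[of "s k" x] by linarith
      from mult_right_mono[OF this u_nonneg[of x]]
      show "norm (F k x) \<le> norm (dens_dil (s k) x * u x + pdens x)"
        using F0[of k x] dens_nonneg(1)[of x] dens_nonneg(2)[of "s k" x] u_nonneg[of x]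
        by (simp add: F_def distrib_right dens_mult_eq)
    qed
  qed simp
  have sat: "filterlim s (at 0) sequentially"
    using s by (intro filterlim_atI) auto
  have conv: "(\<lambda>k. c k * (w (exp (s k) *\<^sub>R x) * u (exp (s k) *\<^sub>R x) powr r)) \<longlonglongrightarrow> w x * u x powr r"
      if "c \<longlonglongrightarrow> 1" for x r c
  proof -
    have 1: "(\<lambda>k. w (exp (s k) *\<^sub>R x) * u (exp (s k) *\<^sub>R x) powr r) \<longlonglongrightarrow> w x * u x powr r"
    \<comment> \<open>Where w vanishes, it vanishes on the whole ray by homogeneity, and nothing
      about u is required there.\<close>
    proof (cases "w x = 0")
      case False
      have "(\<lambda>k. u (exp (s k) *\<^sub>R x)) \<longlonglongrightarrow> u x"
        using filterlim_compose[OF cont[OF False] sat] .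
      then have "(\<lambda>k. exp (-\<alpha> * s k) * w x * u (exp (s k) *\<^sub>R x) powr r) \<longlonglongrightarrow> exp (-\<alpha> * 0) * w x * u x powr r"
        using u_pos[OF False] by (intro tendsto_intros s) auto
      then show ?thesis by (simp add: w_hom)
    qed (simp add: w_hom)
    show "(\<lambda>k. c k * (w (exp (s k) *\<^sub>R x) * u (exp (s k) *\<^sub>R x) powr r)) \<longlonglongrightarrow> w x * u x powr r"
      using tendsto_mult[OF that 1] by simp
  qed
  have exps: "(\<lambda>k. exp (c * s k)) \<longlonglongrightarrow> 1" for c
  proof -
    have "(\<lambda>k. exp (c * s k)) \<longlonglongrightarrow> exp (c * 0)" by (intro tendsto_intros s)
    then show ?thesis by simp
  qed
  have dens_lim: "(\<lambda>k. dens_dil (s k) x) \<longlonglongrightarrow> dens x" for x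
    unfolding dens_dil_def dens_def by (rule conv[OF exps])
  have pdens_lim: "(\<lambda>k. pdens_dil (s k) x) \<longlonglongrightarrow> pdens x" for x
    unfolding pdens_dil_def pdens_def by (rule conv[OF exps])
  have F_lim: "(\<lambda>k. F k x) \<longlonglongrightarrow> 0" for x
    unfolding F_def
    using tendsto_mult[OF tendsto_rabs[OF tendsto_diff[OF dens_lim[of x] tendsto_const[of "dens x"]]] tendsto_const[of "u x"]]
    by simp
  have nn: "(\<lambda>k. \<integral>\<^sup>+x. norm (pdens_dil (s k) x - pdens x) \<partial>lborel) \<longlonglongrightarrow> 0"
  proof (rule Scheffe_lemma2)
    fix k
    have "(\<integral>\<^sup>+x. norm (pdens_dil (s k) x) \<partial>lborel) = ennreal (\<integral>x. pdens_dil (s k) x \<partial>lborel)"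
      using dens_nonneg integrable_pdens_dil by (simp add: nn_integral_eq_integral)
    also have "\<dots> = ennreal (\<integral>x. pdens x \<partial>lborel)" using integral_pdens_dil[of "\<lambda>_. 1" "s k"] by simp
    also have "\<dots> = (\<integral>\<^sup>+x. norm (pdens x) \<partial>lborel)"
      using dens_nonneg integrable_pdens by (simp add: nn_integral_eq_integral)
    finally show "(\<integral>\<^sup>+x. norm (pdens_dil (s k) x) \<partial>lborel) \<le> (\<integral>\<^sup>+x. norm (pdens x) \<partial>lborel)" by simp
  qed (use integrable_pdens pdens_lim in auto)
  have pint: "integrable lborel (\<lambda>x. \<bar>pdens_dil (s k) x - pdens x\<bar>)" for k
    using integrable_pdens integrable_pdens_dil by simp
  have "(\<lambda>k. enn2real (\<integral>\<^sup>+x. norm (pdens_dil (s k) x - pdens x) \<partial>lborel)) \<longlonglongrightarrow> 0"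
    by (rule tendsto_enn2real) (use nn in simp_all)
  then have L1: "(\<lambda>k. \<integral>x. \<bar>pdens_dil (s k) x - pdens x\<bar> \<partial>lborel) \<longlonglongrightarrow> 0"
    by (simp add: integral_eq_nn_integral)
  have int3: "integrable lborel (\<lambda>x. 3 * pdens x)" using integrable_pdens by simp
  have L2: "(\<lambda>k. \<integral>x. min (F k x) (3 * pdens x) \<partial>lborel) \<longlonglongrightarrow> (\<integral>x. 0 \<partial>(lborel :: 'a measure))"
  proof (rule integral_dominated_convergence[where w = "\<lambda>x. 3 * pdens x"])
    have "(\<lambda>k. min (F k x) (3 * pdens x)) \<longlonglongrightarrow> min 0 (3 * pdens x)" for x
      by (intro tendsto_intros F_lim)
    then show "AE x in lborel. (\<lambda>k. min (F k x) (3 * pdens x)) \<longlonglongrightarrow> 0"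
      using dens_nonneg by (simp add: min_absorb1)
  qed (use int3 F0 dens_nonneg in \<open>auto simp: abs_of_nonneg\<close>)
  have mint: "integrable lborel (\<lambda>x. min (F k x) (3 * pdens x))" for k
    using Fint int3 by (intro integrable_min)
  \<comment> \<open>Young's inequality bounds F by \<open>pdens_dil\<close> + 2
    \<open>pdens\<close>, hence by 3 \<open>pdens\<close> plus the distance between
    \<open>pdens_dil\<close> and \<open>pdens\<close>. The truncated part is handled by dominated
    convergence, the excess by the Scheffe limit.\<close>
  have F_le: "(\<integral>x. F k x \<partial>lborel) \<le> (\<integral>x. min (F k x) (3 * pdens x) \<partial>lborel) + (\<integral>x. \<bar>pdens_dil (s k) x - pdens x\<bar> \<partial>lborel)" for k
  proof -
    have "(\<integral>x. F k x \<partial>lborel) \<le> (\<integral>x. min (F k x) (3 * pdens x) + \<bar>pdens_dil (s k) x - pdens x\<bar> \<partial>lborel)"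
    proof (intro integral_mono Fint Bochner_Integration.integrable_add mint pint)
      fix x
      have "\<bar>dens_dil (s k) x - dens x\<bar> \<le> dens_dil (s k) x + dens x"
        using dens_nonneg(1)[of x] dens_nonneg(2)[of "s k" x] by linarith
      from mult_right_mono[OF this u_nonneg[of x]]
      have "F k x \<le> dens_dil (s k) x * u x + pdens x" by (simp add: F_def distrib_right dens_mult_eq)
      moreover have "p / (p + 1) * pdens_dil (s k) x \<le> 1 * pdens_dil (s k) x"
        "1 / (p + 1) * pdens x \<le> 1 * pdens x"
        using dens_nonneg p_pos by (intro mult_right_mono; simp)+
      ultimately have "F k x \<le> pdens_dil (s k) x + 2 * pdens x"
        using dens_dil_mult_le[of "s k" x] by linarith
      then show "F k x \<le> min (F k x) (3 * pdens x) + \<bar>pdens_dil (s k) x - pdens x\<bar>"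
        by linarith
    qed
    also have "\<dots> = (\<integral>x. min (F k x) (3 * pdens x) \<partial>lborel) + (\<integral>x. \<bar>pdens_dil (s k) x - pdens x\<bar> \<partial>lborel)"
      using mint pint by (rule Bochner_Integration.integral_add)
    finally show ?thesis .
  qed
  have lim: "(\<lambda>k. (\<integral>x. min (F k x) (3 * pdens x) \<partial>lborel) + (\<integral>x. \<bar>pdens_dil (s k) x - pdens x\<bar> \<partial>lborel)) \<longlonglongrightarrow> 0"
    using tendsto_add[OF L2 L1] by simp
  have F_int: "0 \<le> (\<integral>x. F k x \<partial>lborel)" for k
    using F0 by (rule Bochner_Integration.integral_nonneg)
  have "(\<lambda>k. \<integral>x. F k x \<partial>lborel) \<longlonglongrightarrow> 0"
    by (rule tendsto_sandwich[OF always_eventually always_eventually tendsto_const lim])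
      (use F_le F_int in auto)
  then show ?thesis by (simp add: F_def)
qed

end

section \<open>Dilation-homogeneous integral systems\<close>

text \<open>\<open>K_diff\<close> isolates the only fine information about the kernel: dilating x
  alone while the cutoff difference is present costs |t| times terms of size C/R or Q. The function
  Q carries the behaviour near the diagonal; being bounded and tending to 0 pointwise, it disappears
  under the double integral as R grows.\<close>

locale dilation_system = U: weighted_power w u p \<alpha> + V: weighted_power z v q \<beta>
  for w u :: "'a::euclidean_space \<Rightarrow> real" and p \<alpha> :: real
    and z v :: "'b::euclidean_space \<Rightarrow> real" and q \<beta> :: real +
  fixes K :: "'a \<Rightarrow> 'b \<Rightarrow> real" and \<kappa> C Q0 :: real and Q :: "real \<Rightarrow> 'a \<Rightarrow> 'b \<Rightarrow> real"
  assumes K_meas [measurable]: "(\<lambda>(\<xi>, x). K \<xi> x) \<in> borel_measurable (lborel \<Otimes>\<^sub>M lborel)"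
    and K_nonneg: "K \<xi> x \<ge> 0"
    and K_hom: "K (exp t *\<^sub>R \<xi>) (exp t *\<^sub>R x) = exp (-\<kappa> * t) * K \<xi> x"
    and u_eq: "ennreal (u \<xi>) = (\<integral>\<^sup>+x. ennreal (K \<xi> x * V.dens x) \<partial>lborel)"
    and v_eq: "ennreal (v x) = (\<integral>\<^sup>+\<xi>. ennreal (K \<xi> x * U.dens \<xi>) \<partial>lborel)"
    and u_pos: "u \<xi> > 0"
    and u_lip: "\<exists>L\<ge>0. \<forall>t \<xi>. \<bar>t\<bar> \<le> 1 \<longrightarrow> norm \<xi> \<le> \<rho> \<longrightarrow> \<bar>ln (u (exp t *\<^sub>R \<xi>)) - ln (u \<xi>)\<bar> \<le> L * \<bar>t\<bar>"
    and v_pos: "z x \<noteq> 0 \<Longrightarrow> v x > 0"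
    and v_cont: "z x \<noteq> 0 \<Longrightarrow> ((\<lambda>t. v (exp t *\<^sub>R x)) \<longlongrightarrow> v x) (at 0)"
    and C_nonneg: "C \<ge> 0"
    and Q_meas [measurable]: "(\<lambda>(\<xi>, x). Q R \<xi> x) \<in> borel_measurable (lborel \<Otimes>\<^sub>M lborel)"
    and Q_nonneg: "Q R \<xi> x \<ge> 0"
    and Q_le: "R \<ge> 1 \<Longrightarrow> Q R \<xi> x \<le> Q0"
    and Q_lim: "(\<lambda>k. Q (real (Suc k)) \<xi> x) \<longlonglongrightarrow> 0"
    and K_diff: "R \<ge> 1 \<Longrightarrow> \<bar>t\<bar> \<le> 1/8 \<Longrightarrow>
      kt = exp (- ((DIM('b) - \<beta>) / (q + 1)) * t) * K \<xi> (exp (-t) *\<^sub>R x) \<Longrightarrow>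
      \<bar>kt * (log_cutoff R (norm (exp (-t) *\<^sub>R x)) - log_cutoff R (norm \<xi>))
        - K \<xi> x * (log_cutoff R (norm x) - log_cutoff R (norm \<xi>))\<bar>
      \<le> \<bar>t\<bar> * (C / R * (kt + K \<xi> x) + Q R \<xi> x * K \<xi> x)"
begin

section \<open>Double integrals against the kernel\<close>

abbreviation P :: "('a \<times> 'b) measure" where "P \<equiv> lborel \<Otimes>\<^sub>M lborel"

context notes lborel_prod [simp del] begin

text \<open>Integrating over x first turns the kernel into u by \<open>u_eq\<close>. Tonelli with
  absolute values settles integrability, and Fubini then gives the value.\<close>

lemma integrable_U_pair:
  assumes [measurable]: "F \<in> borel_measurable borel" and int: "integrable lborel (\<lambda>\<xi>. F \<xi> * u \<xi>)"
  shows "integrable P (\<lambda>(\<xi>, x). F \<xi> * (K \<xi> x * V.dens x))" (is ?A)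
    and "(\<integral>(\<xi>, x). F \<xi> * (K \<xi> x * V.dens x) \<partial>P) = (\<integral>\<xi>. F \<xi> * u \<xi> \<partial>lborel)" (is ?B)
proof -
  have inner: "(\<integral>x. K \<xi> x * V.dens x \<partial>lborel) = u \<xi>" for \<xi>
    using u_eq[of \<xi>] K_nonneg V.dens_nonneg(1) u_pos[of \<xi>]
    by (subst integral_eq_nn_integral) (auto simp: less_imp_le)
  have "(\<integral>\<^sup>+y. norm (case y of (\<xi>, x) \<Rightarrow> F \<xi> * (K \<xi> x * V.dens x)) \<partial>P) =
      (\<integral>\<^sup>+\<xi>. \<integral>\<^sup>+x. norm (F \<xi> * (K \<xi> x * V.dens x)) \<partial>lborel \<partial>lborel)"
    by (subst lborel.nn_integral_fst[symmetric]) simp_all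
  also have "\<dots> = (\<integral>\<^sup>+\<xi>. ennreal \<bar>F \<xi>\<bar> * ennreal (u \<xi>) \<partial>lborel)"
    unfolding u_eq
    by (subst nn_integral_cmult[symmetric])
       (simp_all add: abs_mult K_nonneg V.dens_nonneg ennreal_mult)
  also have "\<dots> = (\<integral>\<^sup>+\<xi>. norm (F \<xi> * u \<xi>) \<partial>lborel)"
    by (intro nn_integral_cong) (simp add: abs_mult ennreal_mult U.u_nonneg)
  also have "\<dots> < \<infinity>" using int by (simp add: integrable_iff_bounded)
  finally show A: ?A by (subst integrable_iff_bounded) simp
  show ?B using lborel_pair.integral_fst[OF A] inner by simp
qed

lemma integrable_V_pair:
  assumes [measurable]: "F \<in> borel_measurable borel" and int: "integrable lborel (\<lambda>x. F x * v x)"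
  shows "integrable P (\<lambda>(\<xi>, x). F x * (K \<xi> x * U.dens \<xi>))" (is ?A)
    and "(\<integral>(\<xi>, x). F x * (K \<xi> x * U.dens \<xi>) \<partial>P) = (\<integral>x. F x * v x \<partial>lborel)" (is ?B)
proof -
  have inner: "(\<integral>\<xi>. K \<xi> x * U.dens \<xi> \<partial>lborel) = v x" for x
    using v_eq[of x, symmetric] K_nonneg U.dens_nonneg(1) V.u_nonneg[of x]
    by (subst integral_eq_nn_integral) auto
  have "(\<integral>\<^sup>+y. norm (case y of (\<xi>, x) \<Rightarrow> F x * (K \<xi> x * U.dens \<xi>)) \<partial>P) =
      (\<integral>\<^sup>+x. \<integral>\<^sup>+\<xi>. norm (F x * (K \<xi> x * U.dens \<xi>)) \<partial>lborel \<partial>lborel)"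
    by (subst lborel_pair.nn_integral_snd[symmetric]) simp_all
  also have "\<dots> = (\<integral>\<^sup>+x. ennreal \<bar>F x\<bar> * ennreal (v x) \<partial>lborel)"
    unfolding v_eq
    by (subst nn_integral_cmult[symmetric])
       (simp_all add: abs_mult K_nonneg U.dens_nonneg ennreal_mult)
  also have "\<dots> = (\<integral>\<^sup>+x. norm (F x * v x) \<partial>lborel)"
    by (intro nn_integral_cong) (simp add: abs_mult ennreal_mult V.u_nonneg)
  also have "\<dots> < \<infinity>" using int by (simp add: integrable_iff_bounded)
  finally show A: ?A by (subst integrable_iff_bounded) simp
  show ?B using lborel_pair.integral_snd[OF A] inner by simp
qed

section \<open>The energy and its dilates\<close>

definition energy :: real where "energy = (\<integral>\<xi>. U.pdens \<xi> \<partial>lborel)"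

lemma energy_nonneg: "energy \<ge> 0"
  unfolding energy_def by (intro Bochner_Integration.integral_nonneg U.dens_nonneg)

text \<open>The first digit tells whether the density of u is dilated, the second whether that of v
  is.\<close>

abbreviation e00 :: "'a \<times> 'b \<Rightarrow> real" where "e00 \<equiv> (\<lambda>(\<xi>, x). K \<xi> x * U.dens \<xi> * V.dens x)"
abbreviation e10 :: "real \<Rightarrow> 'a \<times> 'b \<Rightarrow> real" where "e10 t \<equiv> (\<lambda>(\<xi>, x). K \<xi> x * U.dens_dil t \<xi> * V.dens x)"
abbreviation e01 :: "real \<Rightarrow> 'a \<times> 'b \<Rightarrow> real" where "e01 t \<equiv> (\<lambda>(\<xi>, x). K \<xi> x * U.dens \<xi> * V.dens_dil t x)"
abbreviation e11 :: "real \<Rightarrow> 'a \<times> 'b \<Rightarrow> real" where "e11 t \<equiv> (\<lambda>(\<xi>, x). K \<xi> x * U.dens_dil t \<xi> * V.dens_dil t x)"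

text \<open>A multiplier in \<xi> alone passes through the inner integral over x, which produces u
  as long as the density of v is undilated. The counterpart for v needs a multiplier in x alone,
  which forces two different cutoffs later.\<close>

lemma U_integral_mult:
  assumes [measurable]: "\<psi> \<in> borel_measurable borel" and "\<And>\<xi>. \<bar>\<psi> \<xi>\<bar> \<le> 1"
  shows "integrable P (\<lambda>(\<xi>, x). \<psi> \<xi> * e00 (\<xi>, x))" "integrable P (\<lambda>(\<xi>, x). \<psi> \<xi> * e10 t (\<xi>, x))"
    "(\<integral>(\<xi>, x). \<psi> \<xi> * e00 (\<xi>, x) \<partial>P) = (\<integral>\<xi>. \<psi> \<xi> * U.pdens \<xi> \<partial>lborel)"
    "(\<integral>(\<xi>, x). \<psi> \<xi> * e10 t (\<xi>, x) \<partial>P) = (\<integral>\<xi>. \<psi> \<xi> * (U.dens_dil t \<xi> * u \<xi>) \<partial>lborel)"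
  using integrable_U_pair[of "\<lambda>\<xi>. \<psi> \<xi> * U.dens \<xi>"] integrable_U_pair[of "\<lambda>\<xi>. \<psi> \<xi> * U.dens_dil t \<xi>"]
    U.integrable_bounded_mult_pdens[of \<psi>, OF assms]
  by (simp_all add: mult.assoc U.dens_mult_eq mult.left_commute[of "K _ _"])

lemma V_integral_mult:
  assumes [measurable]: "\<psi> \<in> borel_measurable borel" and "\<And>x. \<bar>\<psi> x\<bar> \<le> 1"
  shows "integrable P (\<lambda>(\<xi>, x). \<psi> x * e00 (\<xi>, x))" "integrable P (\<lambda>(\<xi>, x). \<psi> x * e01 t (\<xi>, x))"
    "(\<integral>(\<xi>, x). \<psi> x * e00 (\<xi>, x) \<partial>P) = (\<integral>x. \<psi> x * V.pdens x \<partial>lborel)"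
    "(\<integral>(\<xi>, x). \<psi> x * e01 t (\<xi>, x) \<partial>P) = (\<integral>x. \<psi> x * (V.dens_dil t x * v x) \<partial>lborel)"
  using integrable_V_pair[of "\<lambda>x. \<psi> x * V.dens x"] integrable_V_pair[of "\<lambda>x. \<psi> x * V.dens_dil t x"]
    V.integrable_bounded_mult_pdens[of \<psi>, OF assms]
  by (simp_all add: mult.assoc V.dens_mult_eq mult.left_commute[of "K _ _"] mult.commute[of "U.dens _"])

lemma integrable_e: "integrable P e00" "integrable P (e01 t)"
  using U_integral_mult(1)[of "\<lambda>_. 1"] V_integral_mult(2)[of "\<lambda>_. 1"] by simp_all

lemma integral_e00: "integral\<^sup>L P e00 = energy"
  using U_integral_mult(3)[of "\<lambda>_. 1"] by (simp add: energy_def)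

text \<open>Both weighted norms equal the undilated double integral, evaluated in either
  order.\<close>

lemma energy_eq: "energy = (\<integral>x. V.pdens x \<partial>lborel)"
  using V_integral_mult(3)[of "\<lambda>_. 1"] integral_e00 by simp

lemma integral_e01_le: "integral\<^sup>L P (e01 t) \<le> energy"
  using V_integral_mult(4)[of "\<lambda>_. 1"] V.integral_dens_dil_mult_le[of t] energy_eq by simp

definition defect :: real where
  "defect = (DIM('a) - \<alpha>) / (p + 1) + (DIM('b) - \<beta>) / (q + 1) - \<kappa>"

text \<open>The powers of exp t are the Jacobian of the joint dilation. They are kept apart so that
  the change of variables cancels them and leaves exactly exp (- \<open>defect\<close> t).\<close>

lemma e11_eq: "e11 t (\<xi>, x) =
    exp (- defect * t) * exp t ^ DIM('a) * exp t ^ DIM('b) * e00 (exp t *\<^sub>R \<xi>, exp t *\<^sub>R x)"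
proof -
  have "exp (- defect * t) * exp t ^ DIM('a) * exp t ^ DIM('b) * exp (-\<kappa> * t) =
      exp ((DIM('a) - (DIM('a) - \<alpha>) / (p + 1)) * t) * exp ((DIM('b) - (DIM('b) - \<beta>) / (q + 1)) * t)"
    unfolding exp_of_nat_mult[symmetric] exp_add[symmetric]
    by (simp add: defect_def algebra_simps)
  then show ?thesis
    by (simp add: U.dens_dil_def V.dens_dil_def K_hom mult.assoc[symmetric])
qed

lemma e11_integral:
  assumes [measurable]: "\<psi> \<in> borel_measurable borel" and \<psi>: "\<And>\<xi>. \<bar>\<psi> \<xi>\<bar> \<le> 1"
  shows "integrable P (\<lambda>(\<xi>, x). \<psi> \<xi> * e11 t (\<xi>, x))"
    and "(\<integral>(\<xi>, x). \<psi> \<xi> * e11 t (\<xi>, x) \<partial>P) =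
      exp (- defect * t) * (\<integral>\<xi>. \<psi> (exp (-t) *\<^sub>R \<xi>) * U.pdens \<xi> \<partial>lborel)"
proof -
  define F where "F = (\<lambda>(\<xi>, x). \<psi> (exp (-t) *\<^sub>R \<xi>) * e00 (\<xi>, x))"
  have \<psi>': "\<bar>\<psi> (exp (-t) *\<^sub>R \<xi>)\<bar> \<le> 1" for \<xi> by (rule \<psi>)
  have F: "integrable P F" "integral\<^sup>L P F = (\<integral>\<xi>. \<psi> (exp (-t) *\<^sub>R \<xi>) * U.pdens \<xi> \<partial>lborel)"
    unfolding F_def using U_integral_mult(1,3)[of "\<lambda>\<xi>. \<psi> (exp (-t) *\<^sub>R \<xi>)", OF _ \<psi>'] by simp_all
  have [measurable]: "F \<in> borel_measurable P" using F(1) by simp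
  have e: "(\<lambda>(\<xi>, x). \<psi> \<xi> * e11 t (\<xi>, x)) =
      (\<lambda>y. exp (- defect * t) * exp t ^ DIM('a) * exp t ^ DIM('b) * (case y of (\<xi>, x) \<Rightarrow> F (exp t *\<^sub>R \<xi>, exp t *\<^sub>R x)))"
    unfolding e11_eq by (auto simp: F_def fun_eq_iff simp flip: exp_add)
  note sc = integral_lborel_pair_scaleR[of F "exp t" "exp t"]
  show "integrable P (\<lambda>(\<xi>, x). \<psi> \<xi> * e11 t (\<xi>, x))"
    unfolding e using sc(2) F by simp
  show "(\<integral>(\<xi>, x). \<psi> \<xi> * e11 t (\<xi>, x) \<partial>P) =
      exp (- defect * t) * (\<integral>\<xi>. \<psi> (exp (-t) *\<^sub>R \<xi>) * U.pdens \<xi> \<partial>lborel)"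
    unfolding e F(2)[symmetric] by (subst sc(1)) simp_all
qed

text \<open>This is the kernel obtained when the dilation of the density of v is moved onto K by
  substituting in x. The exponent is what remains of the normalisation of \<open>V.dens_dil\<close>
  after the Jacobian is removed.\<close>

definition Kdil :: "real \<Rightarrow> 'a \<Rightarrow> 'b \<Rightarrow> real" where
  "Kdil t \<xi> x = exp (- ((DIM('b) - \<beta>) / (q + 1)) * t) * K \<xi> (exp (-t) *\<^sub>R x)"

lemma measurable_Kdil [measurable]: "(\<lambda>(\<xi>, x). Kdil t \<xi> x) \<in> borel_measurable P"
proof -
  have "(\<lambda>(\<xi>, x). (\<xi>, exp (-t) *\<^sub>R x)) \<in> P \<rightarrow>\<^sub>M P" by measurable
  from measurable_compose[OF this K_meas] show ?thesis
    unfolding Kdil_def by (simp add: case_prod_unfold)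
qed

lemma Kdil_integral:
  assumes [measurable]: "(\<lambda>(\<xi>, x). \<psi> \<xi> x) \<in> borel_measurable P"
    and int: "integrable P (\<lambda>(\<xi>, x). \<psi> \<xi> x * e01 t (\<xi>, x))"
  shows "integrable P (\<lambda>(\<xi>, x). \<psi> \<xi> (exp (-t) *\<^sub>R x) * (Kdil t \<xi> x * U.dens \<xi> * V.dens x))"
    and "(\<integral>(\<xi>, x). \<psi> \<xi> (exp (-t) *\<^sub>R x) * (Kdil t \<xi> x * U.dens \<xi> * V.dens x) \<partial>P) =
      (\<integral>(\<xi>, x). \<psi> \<xi> x * e01 t (\<xi>, x) \<partial>P)"
proof -
  define F where "F = (\<lambda>(\<xi>, x). \<psi> \<xi> (exp (-t) *\<^sub>R x) * (Kdil t \<xi> x * U.dens \<xi> * V.dens x))"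
  have "(\<lambda>(\<xi>, x). (\<xi>, exp (-t) *\<^sub>R x)) \<in> P \<rightarrow>\<^sub>M P" by measurable
  from measurable_compose[OF this assms(1)]
  have [measurable]: "(\<lambda>(\<xi>, x). \<psi> \<xi> (exp (-t) *\<^sub>R x)) \<in> borel_measurable P"
    by (simp add: case_prod_unfold)
  have [measurable]: "F \<in> borel_measurable P" unfolding F_def by measurable
  have ex: "exp ((DIM('b) - (DIM('b) - \<beta>) / (q + 1)) * t) = exp t ^ DIM('b) * exp (- ((DIM('b) - \<beta>) / (q + 1)) * t)"
    unfolding exp_of_nat_mult[symmetric] exp_add[symmetric] by (simp add: algebra_simps)
  have e: "(\<lambda>(\<xi>, x). \<psi> \<xi> x * e01 t (\<xi>, x)) =
      (\<lambda>y. exp t ^ DIM('b) * (case y of (\<xi>, x) \<Rightarrow> F (1 *\<^sub>R \<xi>, exp t *\<^sub>R x)))"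
    unfolding V.dens_dil_def ex by (auto simp: F_def Kdil_def fun_eq_iff simp flip: exp_add)
  note sc = integral_lborel_pair_scaleR[of F 1 "exp t"]
  have "integrable P (\<lambda>(\<xi>, x). F (1 *\<^sub>R \<xi>, exp t *\<^sub>R x))" using int unfolding e by simp
  then show "integrable P (\<lambda>(\<xi>, x). \<psi> \<xi> (exp (-t) *\<^sub>R x) * (Kdil t \<xi> x * U.dens \<xi> * V.dens x))"
    using sc(2) by (simp add: F_def)
  show "(\<integral>(\<xi>, x). \<psi> \<xi> (exp (-t) *\<^sub>R x) * (Kdil t \<xi> x * U.dens \<xi> * V.dens x) \<partial>P) =
      (\<integral>(\<xi>, x). \<psi> \<xi> x * e01 t (\<xi>, x) \<partial>P)"
    unfolding e using sc(1) by (simp add: F_def)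
qed

text \<open>The ratio of the two densities is exp X, where the weight contributes exactly -\<alpha>t
  to X even near its singularity, and u contributes O(|t|) by \<open>u_lip\<close>. Thus X = O(|t|),
  uniformly on bounded sets.\<close>

lemma dens_dil_diff_le:
  "\<exists>M\<ge>0. \<forall>t \<xi>. \<bar>t\<bar> \<le> 1 \<longrightarrow> norm \<xi> \<le> \<rho> \<longrightarrow> \<bar>U.dens_dil t \<xi> - U.dens \<xi>\<bar> \<le> M * \<bar>t\<bar> * U.dens \<xi>"
proof -
  from u_lip[of \<rho>] obtain L where L: "L \<ge> 0"
    "\<And>t \<xi>. \<bar>t\<bar> \<le> 1 \<Longrightarrow> norm \<xi> \<le> \<rho> \<Longrightarrow> \<bar>ln (u (exp t *\<^sub>R \<xi>)) - ln (u \<xi>)\<bar> \<le> L * \<bar>t\<bar>"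
    by blast
  define A where "A = DIM('a) - (DIM('a) - \<alpha>) / (p + 1) - \<alpha>"
  define Y where "Y = \<bar>A\<bar> + p * L"
  have Y: "Y \<ge> 0" using L U.p_pos by (simp add: Y_def)
  have "\<bar>U.dens_dil t \<xi> - U.dens \<xi>\<bar> \<le> Y * exp Y * \<bar>t\<bar> * U.dens \<xi>" if t: "\<bar>t\<bar> \<le> 1" "norm \<xi> \<le> \<rho>" for t \<xi>
  proof -
    define X where "X = A * t + p * (ln (u (exp t *\<^sub>R \<xi>)) - ln (u \<xi>))"
    have "\<bar>X\<bar> \<le> \<bar>A * t\<bar> + \<bar>p * (ln (u (exp t *\<^sub>R \<xi>)) - ln (u \<xi>))\<bar>"
      unfolding X_def by (rule abs_triangle_ineq)
    also have "\<dots> \<le> \<bar>A\<bar> * \<bar>t\<bar> + p * (L * \<bar>t\<bar>)"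
      unfolding abs_mult using L(2)[OF t] U.p_pos by (intro add_mono mult_mono) auto
    also have "\<dots> = Y * \<bar>t\<bar>" by (simp add: Y_def algebra_simps)
    finally have X1: "\<bar>X\<bar> \<le> Y * \<bar>t\<bar>" .
    also have "\<dots> \<le> Y * 1" using Y t by (intro mult_left_mono) auto
    finally have X2: "\<bar>X\<bar> \<le> Y" by simp
    have "u (exp t *\<^sub>R \<xi>) powr p = exp (p * (ln (u (exp t *\<^sub>R \<xi>)) - ln (u \<xi>))) * u \<xi> powr p"
      using u_pos[of \<xi>] u_pos[of "exp t *\<^sub>R \<xi>"] by (simp add: powr_def algebra_simps flip: exp_add)
    moreover have "exp X = exp ((DIM('a) - (DIM('a) - \<alpha>) / (p + 1)) * t) * exp (-\<alpha> * t)
       * exp (p * (ln (u (exp t *\<^sub>R \<xi>)) - ln (u \<xi>)))"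
      unfolding exp_add[symmetric] by (simp add: X_def A_def algebra_simps)
    ultimately have "U.dens_dil t \<xi> = exp X * U.dens \<xi>"
      by (simp add: U.dens_dil_def U.dens_def U.w_hom)
    then have "U.dens_dil t \<xi> - U.dens \<xi> = (exp X - 1) * U.dens \<xi>" by (simp add: algebra_simps)
    then have "\<bar>U.dens_dil t \<xi> - U.dens \<xi>\<bar> = \<bar>exp X - 1\<bar> * U.dens \<xi>"
      using U.dens_nonneg by (simp add: abs_mult)
    also have "\<dots> \<le> (\<bar>X\<bar> * exp Y) * U.dens \<xi>"
      using U.dens_nonneg by (intro mult_right_mono abs_exp_minus_one_le X2)
    also have "\<dots> \<le> (Y * \<bar>t\<bar> * exp Y) * U.dens \<xi>"
      using U.dens_nonneg X1 by (intro mult_right_mono) auto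
    finally show ?thesis by (simp add: mult_ac)
  qed
  then show ?thesis using Y by (intro exI[of _ "Y * exp Y"]) auto
qed

section \<open>The error from the diagonal\<close>

definition near_energy :: "real \<Rightarrow> real" where
  "near_energy R = (\<integral>(\<xi>, x). Q R \<xi> x * e00 (\<xi>, x) \<partial>P)"

lemma integrable_near_energy: "R \<ge> 1 \<Longrightarrow> integrable P (\<lambda>(\<xi>, x). Q R \<xi> x * e00 (\<xi>, x))"
proof (rule Bochner_Integration.integrable_bound)
  assume R: "R \<ge> 1"
  show "integrable P (\<lambda>y. Q0 * e00 y)" using integrable_e(1) by simp
  have "\<bar>Q R \<xi> x * e00 (\<xi>, x)\<bar> \<le> \<bar>Q0 * e00 (\<xi>, x)\<bar>" for \<xi> x
    unfolding abs_mult using Q_le[OF R, of \<xi> x] Q_nonneg[of R \<xi> x] by (intro mult_right_mono) auto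
  then show "AE y in P. norm (case y of (\<xi>, x) \<Rightarrow> Q R \<xi> x * e00 (\<xi>, x)) \<le> norm (Q0 * e00 y)"
    by auto
qed simp

text \<open>Dominated convergence: Q tends to 0 pointwise and is bounded by Q0, while the undilated
  integrand is integrable.\<close>

lemma near_energy_tendsto: "(\<lambda>k. near_energy (real (Suc k))) \<longlonglongrightarrow> 0"
proof -
  have "(\<lambda>k. near_energy (real (Suc k))) \<longlonglongrightarrow> (\<integral>y. 0 \<partial>P)"
    unfolding near_energy_def
  proof (rule integral_dominated_convergence[where w = "\<lambda>y. Q0 * e00 y"])
    show "integrable P (\<lambda>y. Q0 * e00 y)" using integrable_e(1) by simp
    have "(\<lambda>k. Q (real (Suc k)) \<xi> x * e00 (\<xi>, x)) \<longlonglongrightarrow> 0 * e00 (\<xi>, x)" for \<xi> x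
      by (intro tendsto_mult Q_lim tendsto_const)
    then show "AE y in P. (\<lambda>k. case y of (\<xi>, x) \<Rightarrow> Q (real (Suc k)) \<xi> x * e00 (\<xi>, x)) \<longlonglongrightarrow> 0"
      by auto
    have "e00 (\<xi>, x) \<ge> 0" for \<xi> x using K_nonneg U.dens_nonneg V.dens_nonneg by simp
    then have "\<bar>Q (real (Suc k)) \<xi> x * e00 (\<xi>, x)\<bar> \<le> Q0 * e00 (\<xi>, x)" for \<xi> x k
      unfolding abs_mult using Q_le[of "real (Suc k)" \<xi> x] Q_nonneg[of "real (Suc k)" \<xi> x]
      by (intro mult_mono) auto
    then show "AE y in P. norm (case y of (\<xi>, x) \<Rightarrow> Q (real (Suc k)) \<xi> x * e00 (\<xi>, x)) \<le> Q0 * e00 y" for k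
      by auto
  qed simp_all
  then show ?thesis by simp
qed

text \<open>The bound has the form |t| times quantities that vanish in the order t to 0, then R to
  infinity. The constant M may depend on R, which is harmless because it multiplies an integral that
  tends to 0 with t.\<close>

lemma dilation_inequality:
  assumes R: "R \<ge> 1" and t: "\<bar>t\<bar> \<le> 1/8" and M: "M \<ge> 0"
    and dens_diff: "\<And>\<xi>. norm \<xi> \<le> exp R \<Longrightarrow> \<bar>U.dens_dil t \<xi> - U.dens \<xi>\<bar> \<le> M * \<bar>t\<bar> * U.dens \<xi>"
  shows "(exp (- defect * t) - 1) * (\<integral>\<xi>. log_cutoff R (norm \<xi>) * U.pdens \<xi> \<partial>lborel)
    \<le> \<bar>t\<bar> * ((2 + exp \<bar>defect\<bar> + 2 * C) * energy / R + near_energy R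
        + M * (\<integral>x. \<bar>V.dens_dil t x - V.dens x\<bar> * v x \<partial>lborel))"
proof -
  define \<phi> where "\<phi> \<xi> = log_cutoff R (norm \<xi>)" for \<xi> :: 'a
  define \<theta> where "\<theta> x = log_cutoff R (norm x)" for x :: 'b
  have [measurable]: "\<phi> \<in> borel_measurable borel" unfolding \<phi>_def[abs_def] by measurable
  have [measurable]: "\<theta> \<in> borel_measurable borel" unfolding \<theta>_def[abs_def] by measurable
  have \<phi>: "\<bar>\<phi> \<xi>\<bar> \<le> 1" "\<phi> \<xi> \<ge> 0" "\<phi> \<xi> \<le> 1" for \<xi> by (simp_all add: \<phi>_def)
  have \<theta>: "\<bar>\<theta> x\<bar> \<le> 1" "\<theta> x \<ge> 0" for x by (simp_all add: \<theta>_def)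
  have \<phi>': "\<bar>\<phi> (exp (-t) *\<^sub>R \<xi>)\<bar> \<le> 1" for \<xi> by (rule \<phi>)
  have \<theta>\<phi>: "\<bar>\<theta> x - \<phi> \<xi>\<bar> \<le> 1" for x \<xi> unfolding \<theta>_def \<phi>_def by (rule abs_log_cutoff_diff_le_1)
  define \<Phi> where "\<Phi> = (\<integral>\<xi>. \<phi> \<xi> * U.pdens \<xi> \<partial>lborel)"

  note U00 = U_integral_mult(1,3)[of \<phi>, OF _ \<phi>(1)] note U10 = U_integral_mult(2,4)[of \<phi> t, OF _ \<phi>(1)]
  note V00 = V_integral_mult(1,3)[of \<theta>, OF _ \<theta>(1)] note V01 = V_integral_mult(2,4)[of \<theta> t, OF _ \<theta>(1)]
  note U11 = e11_integral[of \<phi> t, OF _ \<phi>(1)]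
  have i01: "integrable P (\<lambda>(\<xi>, x). \<phi> \<xi> * e01 t (\<xi>, x))"
    by (rule Bochner_Integration.integrable_bound[OF integrable_e(2)[of t]])
      (auto simp: abs_mult \<phi> K_nonneg U.dens_nonneg V.dens_nonneg intro!: mult_left_le_one_le AE_I2)
  have icd: "integrable P (\<lambda>(\<xi>, x). (\<theta> x - \<phi> \<xi>) * e01 t (\<xi>, x))" "integrable P (\<lambda>(\<xi>, x). (\<theta> x - \<phi> \<xi>) * e00 (\<xi>, x))"
    using i01 V01(1) V00(1) U00(1) by (simp_all add: case_prod_unfold left_diff_distrib)

  \<comment> \<open>G and H are the first variations, each cut off in its own variable so that
    Young's inequality applies after the other variable is integrated out. D is the product of the
    two differences. T2 and T3 collect the mismatch between the two cutoffs.\<close>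
  define G where "G = (\<integral>(\<xi>, x). \<phi> \<xi> * (e10 t (\<xi>, x) - e00 (\<xi>, x)) \<partial>P)"
  define H where "H = (\<integral>(\<xi>, x). \<theta> x * (e01 t (\<xi>, x) - e00 (\<xi>, x)) \<partial>P)"
  define D where "D = (\<integral>(\<xi>, x). \<phi> \<xi> * (e11 t (\<xi>, x) - e10 t (\<xi>, x) - e01 t (\<xi>, x) + e00 (\<xi>, x)) \<partial>P)"
  define T1 where "T1 = (\<integral>(\<xi>, x). \<phi> \<xi> * e11 t (\<xi>, x) \<partial>P)"
  define T2 where "T2 = (\<integral>(\<xi>, x). (\<theta> x - \<phi> \<xi>) * e01 t (\<xi>, x) \<partial>P)"
  define T3 where "T3 = (\<integral>(\<xi>, x). (\<theta> x - \<phi> \<xi>) * e00 (\<xi>, x) \<partial>P)"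
  have \<Phi>: "\<Phi> = (\<integral>(\<xi>, x). \<phi> \<xi> * e00 (\<xi>, x) \<partial>P)" using U00 by (simp add: \<Phi>_def)

  have balance: "G + H + D = T1 + T2 - T3 - \<Phi>"
  proof -
    have "G = (\<integral>(\<xi>, x). \<phi> \<xi> * e10 t (\<xi>, x) \<partial>P) - \<Phi>"
      unfolding G_def \<Phi> using U10(1) U00(1)
      by (subst Bochner_Integration.integral_diff[symmetric]) (simp_all add: case_prod_unfold right_diff_distrib)
    moreover have "H = (\<integral>(\<xi>, x). \<theta> x * e01 t (\<xi>, x) \<partial>P) - (\<integral>(\<xi>, x). \<theta> x * e00 (\<xi>, x) \<partial>P)"
      unfolding H_def using V01(1) V00(1)
      by (subst Bochner_Integration.integral_diff[symmetric]) (simp_all add: case_prod_unfold right_diff_distrib)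
    moreover have "D = T1 - (\<integral>(\<xi>, x). \<phi> \<xi> * e10 t (\<xi>, x) \<partial>P) - (\<integral>(\<xi>, x). \<phi> \<xi> * e01 t (\<xi>, x) \<partial>P) + \<Phi>"
      unfolding D_def T1_def \<Phi> using U11(1) U10(1) U00(1) i01
      by (simp add: case_prod_unfold right_diff_distrib distrib_left)
    moreover have "T2 = (\<integral>(\<xi>, x). \<theta> x * e01 t (\<xi>, x) \<partial>P) - (\<integral>(\<xi>, x). \<phi> \<xi> * e01 t (\<xi>, x) \<partial>P)"
      unfolding T2_def using V01(1) i01
      by (subst Bochner_Integration.integral_diff[symmetric]) (simp_all add: case_prod_unfold left_diff_distrib)
    moreover have "T3 = (\<integral>(\<xi>, x). \<theta> x * e00 (\<xi>, x) \<partial>P) - \<Phi>"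
      unfolding T3_def \<Phi> using V00(1) U00(1)
      by (subst Bochner_Integration.integral_diff[symmetric]) (simp_all add: case_prod_unfold left_diff_distrib)
    ultimately show ?thesis by simp
  qed

  have G_le: "G \<le> \<bar>t\<bar> / R * energy"
  proof -
    have "G = (\<integral>\<xi>. \<phi> \<xi> * (U.dens_dil t \<xi> * u \<xi>) \<partial>lborel) - (\<integral>\<xi>. \<phi> \<xi> * U.pdens \<xi> \<partial>lborel)"
      unfolding G_def using U10 U00
      by (simp add: case_prod_unfold right_diff_distrib)
    also have "\<dots> = (\<integral>\<xi>. \<phi> \<xi> * ((U.dens_dil t \<xi> - U.dens \<xi>) * u \<xi>) \<partial>lborel)"
      using U.integrable_bounded_mult_pdens[of \<phi>, OF _ \<phi>(1)]
      by (simp add: left_diff_distrib right_diff_distrib U.dens_mult_eq)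
    also have "\<dots> \<le> \<bar>t\<bar> / R * energy"
      using U.cutoff_dilation_le[of R t] R by (simp add: energy_def \<phi>_def)
    finally show ?thesis .
  qed
  have H_le: "H \<le> \<bar>t\<bar> / R * energy"
  proof -
    have "H = (\<integral>x. \<theta> x * (V.dens_dil t x * v x) \<partial>lborel) - (\<integral>x. \<theta> x * V.pdens x \<partial>lborel)"
      unfolding H_def using V01 V00
      by (simp add: case_prod_unfold right_diff_distrib)
    also have "\<dots> = (\<integral>x. \<theta> x * ((V.dens_dil t x - V.dens x) * v x) \<partial>lborel)"
      using V.integrable_bounded_mult_pdens[of \<theta>, OF _ \<theta>(1)]
      by (simp add: left_diff_distrib right_diff_distrib V.dens_mult_eq)
    also have "\<dots> \<le> \<bar>t\<bar> / R * energy"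
      using V.cutoff_dilation_le[of R t] R by (simp add: energy_eq \<theta>_def)
    finally show ?thesis .
  qed

  \<comment> \<open>The cutoff confines \<xi> to the ball of radius exp R, where the difference in
    \<xi> is O(|t|) times the density. Integrating over \<xi> then reproduces v.\<close>
  have D_le: "D \<le> M * \<bar>t\<bar> * (\<integral>x. \<bar>V.dens_dil t x - V.dens x\<bar> * v x \<partial>lborel)"
  proof -
    have "integrable lborel (\<lambda>x. \<bar>(V.dens_dil t x * v x) - (V.dens x * v x)\<bar>)"
      using V.integrable_dens_dil_mult V.integrable_pdens by (simp add: V.dens_mult_eq)
    then have "integrable lborel (\<lambda>x. \<bar>V.dens_dil t x - V.dens x\<bar> * v x)"
      using V.u_nonneg by (simp add: left_diff_distrib[symmetric] abs_mult)
    note pair = integrable_V_pair[OF _ this]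
    have "D \<le> (\<integral>(\<xi>, x). M * \<bar>t\<bar> * (\<bar>V.dens_dil t x - V.dens x\<bar> * (K \<xi> x * U.dens \<xi>)) \<partial>P)"
      unfolding D_def
    proof (rule integral_mono)
      show "integrable P (\<lambda>(\<xi>, x). \<phi> \<xi> * (e11 t (\<xi>, x) - e10 t (\<xi>, x) - e01 t (\<xi>, x) + e00 (\<xi>, x)))"
        using U11(1) U10(1) U00(1) i01
        by (simp add: case_prod_unfold right_diff_distrib distrib_left)
      show "integrable P (\<lambda>(\<xi>, x). M * \<bar>t\<bar> * (\<bar>V.dens_dil t x - V.dens x\<bar> * (K \<xi> x * U.dens \<xi>)))"
        using pair(1) by (simp add: case_prod_unfold)
      fix y :: "'a \<times> 'b"
      obtain \<xi> x where y: "y = (\<xi>, x)" by force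
      have 1: "\<phi> \<xi> * \<bar>U.dens_dil t \<xi> - U.dens \<xi>\<bar> \<le> M * \<bar>t\<bar> * U.dens \<xi>"
      proof (cases "\<phi> \<xi> = 0")
        case False
        then have "norm \<xi> \<le> exp R" unfolding \<phi>_def using R by (intro log_cutoff_nonzero_imp) auto
        from dens_diff[OF this] show ?thesis
          using \<phi>[of \<xi>] mult_left_le_one_le[of "\<bar>U.dens_dil t \<xi> - U.dens \<xi>\<bar>" "\<phi> \<xi>"] by linarith
      qed (simp add: M U.dens_nonneg)
      have "\<phi> \<xi> * (e11 t (\<xi>, x) - e10 t (\<xi>, x) - e01 t (\<xi>, x) + e00 (\<xi>, x)) =
          \<phi> \<xi> * (U.dens_dil t \<xi> - U.dens \<xi>) * (V.dens_dil t x - V.dens x) * K \<xi> x"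
        by (simp add: algebra_simps)
      also have "\<dots> \<le> \<bar>\<dots>\<bar>" by (rule abs_ge_self)
      also have "\<dots> = (\<phi> \<xi> * \<bar>U.dens_dil t \<xi> - U.dens \<xi>\<bar>) * (\<bar>V.dens_dil t x - V.dens x\<bar> * K \<xi> x)"
        using \<phi>(2)[of \<xi>] K_nonneg[of \<xi> x] by (simp add: abs_mult)
      also have "\<dots> \<le> (M * \<bar>t\<bar> * U.dens \<xi>) * (\<bar>V.dens_dil t x - V.dens x\<bar> * K \<xi> x)"
        using 1 K_nonneg[of \<xi> x] by (intro mult_right_mono) auto
      finally show "(case y of (\<xi>, x) \<Rightarrow> \<phi> \<xi> * (e11 t (\<xi>, x) - e10 t (\<xi>, x) - e01 t (\<xi>, x) + e00 (\<xi>, x)))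
          \<le> (case y of (\<xi>, x) \<Rightarrow> M * \<bar>t\<bar> * (\<bar>V.dens_dil t x - V.dens x\<bar> * (K \<xi> x * U.dens \<xi>)))"
        by (simp add: y mult_ac)
    qed
    also have "\<dots> = M * \<bar>t\<bar> * (\<integral>(\<xi>, x). \<bar>V.dens_dil t x - V.dens x\<bar> * (K \<xi> x * U.dens \<xi>) \<partial>P)"
      by (simp add: case_prod_unfold)
    also have "\<dots> = M * \<bar>t\<bar> * (\<integral>x. \<bar>V.dens_dil t x - V.dens x\<bar> * v x \<partial>lborel)"
      using pair(2) by simp
    finally show ?thesis .
  qed

  \<comment> \<open>T1 scales exactly, except that the cutoff is dilated too; replacing the dilated
    cutoff by the original costs |t|/R times the energy.\<close>
  have T1_ge: "T1 - \<Phi> \<ge> (exp (- defect * t) - 1) * \<Phi> - exp \<bar>defect\<bar> * (\<bar>t\<bar> / R * energy)"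
  proof -
    define \<Phi>t where "\<Phi>t = (\<integral>\<xi>. \<phi> (exp (-t) *\<^sub>R \<xi>) * U.pdens \<xi> \<partial>lborel)"
    have ints: "integrable lborel (\<lambda>\<xi>. \<phi> (exp (-t) *\<^sub>R \<xi>) * U.pdens \<xi>)" "integrable lborel (\<lambda>\<xi>. \<phi> \<xi> * U.pdens \<xi>)"
      using U.integrable_bounded_mult_pdens(1)[of \<phi>, OF _ \<phi>(1)]
        U.integrable_bounded_mult_pdens(1)[of "\<lambda>\<xi>. \<phi> (exp (-t) *\<^sub>R \<xi>)", OF _ \<phi>'] by simp_all
    have "\<Phi> - \<Phi>t = (\<integral>\<xi>. \<phi> \<xi> * U.pdens \<xi> - \<phi> (exp (-t) *\<^sub>R \<xi>) * U.pdens \<xi> \<partial>lborel)"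
      unfolding \<Phi>_def \<Phi>t_def using ints by simp
    also have "\<dots> \<le> (\<integral>\<xi>. \<bar>t\<bar> / R * U.pdens \<xi> \<partial>lborel)"
    proof (rule integral_mono)
      fix \<xi>
      have "\<phi> \<xi> - \<phi> (exp (-t) *\<^sub>R \<xi>) \<le> \<bar>t\<bar> / R"
        using abs_log_cutoff_scale_le[of R "norm \<xi>" "-t"] R by (simp add: \<phi>_def)
      from mult_right_mono[OF this U.dens_nonneg(3)[of \<xi>]]
      show "\<phi> \<xi> * U.pdens \<xi> - \<phi> (exp (-t) *\<^sub>R \<xi>) * U.pdens \<xi> \<le> \<bar>t\<bar> / R * U.pdens \<xi>"
        by (simp add: left_diff_distrib)
    qed (use ints U.integrable_pdens in simp_all)
    also have "\<dots> = \<bar>t\<bar> / R * energy" by (simp add: energy_def)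
    finally have "\<Phi> - \<Phi>t \<le> \<bar>t\<bar> / R * energy" .
    then have "exp (- defect * t) * (\<Phi> - \<Phi>t) \<le> exp (- defect * t) * (\<bar>t\<bar> / R * energy)"
      by (intro mult_left_mono) auto
    also have "\<dots> \<le> exp \<bar>defect\<bar> * (\<bar>t\<bar> / R * energy)"
    proof (rule mult_right_mono)
      have "- defect * t \<le> \<bar>defect * t\<bar>" by simp
      also have "\<dots> \<le> \<bar>defect\<bar> * 1" unfolding abs_mult using t by (intro mult_left_mono) auto
      finally show "exp (- defect * t) \<le> exp \<bar>defect\<bar>" by simp
    qed (use R energy_nonneg in auto)
    finally have "exp (- defect * t) * (\<Phi> - \<Phi>t) \<le> exp \<bar>defect\<bar> * (\<bar>t\<bar> / R * energy)" .
    moreover have "T1 = exp (- defect * t) * \<Phi>t" unfolding T1_def \<Phi>t_def using U11(2) by simp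
    ultimately show ?thesis by (simp add: algebra_simps)
  qed

  \<comment> \<open>Substitution in x writes T2 with \<open>Kdil\<close> and undilated densities. T2
    and T3 then differ only in the kernel and the cutoff, so \<open>K_diff\<close> applies
    pointwise.\<close>
  have T23: "T2 - T3 \<ge> - \<bar>t\<bar> * (2 * C * energy / R + near_energy R)"
  proof -
    let ?f = "\<lambda>(\<xi>, x). (\<theta> (exp (-t) *\<^sub>R x) - \<phi> \<xi>) * (Kdil t \<xi> x * U.dens \<xi> * V.dens x)"
    let ?k = "\<lambda>(\<xi>, x). Kdil t \<xi> x * U.dens \<xi> * V.dens x"
    have f: "integrable P ?f" "integral\<^sup>L P ?f = T2"
      using Kdil_integral[of "\<lambda>\<xi> x. \<theta> x - \<phi> \<xi>" t] icd(1) by (simp_all add: T2_def)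
    have k: "integrable P ?k" "integral\<^sup>L P ?k = integral\<^sup>L P (e01 t)"
      using Kdil_integral[of "\<lambda>\<xi> x. 1" t] integrable_e(2)[of t] by simp_all
    note Q = integrable_near_energy[OF R]
    have "T3 - T2 = (\<integral>y. (case y of (\<xi>, x) \<Rightarrow> (\<theta> x - \<phi> \<xi>) * e00 (\<xi>, x)) - ?f y \<partial>P)"
      unfolding T3_def f(2)[symmetric] using icd(2) f(1)
      by (rule Bochner_Integration.integral_diff[symmetric])
    also have "\<dots> \<le> (\<integral>y. \<bar>t\<bar> * (C / R * (?k y + e00 y) + (case y of (\<xi>, x) \<Rightarrow> Q R \<xi> x * e00 (\<xi>, x))) \<partial>P)"
    proof (rule integral_mono)
      show "integrable P (\<lambda>y. (case y of (\<xi>, x) \<Rightarrow> (\<theta> x - \<phi> \<xi>) * e00 (\<xi>, x)) - ?f y)"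
        using icd(2) f(1) by (rule Bochner_Integration.integrable_diff)
      show "integrable P (\<lambda>y. \<bar>t\<bar> * (C / R * (?k y + e00 y) + (case y of (\<xi>, x) \<Rightarrow> Q R \<xi> x * e00 (\<xi>, x))))"
        by (intro integrable_mult_right Bochner_Integration.integrable_add k(1) integrable_e(1) Q)
      fix y :: "'a \<times> 'b"
      obtain \<xi> x where y: "y = (\<xi>, x)" by force
      have "\<bar>Kdil t \<xi> x * (\<theta> (exp (-t) *\<^sub>R x) - \<phi> \<xi>) - K \<xi> x * (\<theta> x - \<phi> \<xi>)\<bar>
          \<le> \<bar>t\<bar> * (C / R * (Kdil t \<xi> x + K \<xi> x) + Q R \<xi> x * K \<xi> x)"
        unfolding \<theta>_def \<phi>_def by (rule K_diff[OF R t Kdil_def])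
      then have "K \<xi> x * (\<theta> x - \<phi> \<xi>) - Kdil t \<xi> x * (\<theta> (exp (-t) *\<^sub>R x) - \<phi> \<xi>)
          \<le> \<bar>t\<bar> * (C / R * (Kdil t \<xi> x + K \<xi> x) + Q R \<xi> x * K \<xi> x)"
        by linarith
      then have "(K \<xi> x * (\<theta> x - \<phi> \<xi>) - Kdil t \<xi> x * (\<theta> (exp (-t) *\<^sub>R x) - \<phi> \<xi>)) * (U.dens \<xi> * V.dens x)
          \<le> (\<bar>t\<bar> * (C / R * (Kdil t \<xi> x + K \<xi> x) + Q R \<xi> x * K \<xi> x)) * (U.dens \<xi> * V.dens x)"
        using U.dens_nonneg V.dens_nonneg by (intro mult_right_mono) auto
      then show "(case y of (\<xi>, x) \<Rightarrow> (\<theta> x - \<phi> \<xi>) * e00 (\<xi>, x)) - ?f y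
          \<le> \<bar>t\<bar> * (C / R * (?k y + e00 y) + (case y of (\<xi>, x) \<Rightarrow> Q R \<xi> x * e00 (\<xi>, x)))"
        by (simp add: y algebra_simps)
    qed
    also have "\<dots> = \<bar>t\<bar> * (C / R * (integral\<^sup>L P (e01 t) + energy) + near_energy R)"
      using k(1) integrable_e(1) Q k(2) integral_e00 by (simp add: near_energy_def)
    also have "\<dots> \<le> \<bar>t\<bar> * (C / R * (energy + energy) + near_energy R)"
      using integral_e01_le[of t] C_nonneg R by (intro mult_left_mono add_right_mono) auto
    finally show ?thesis by (simp add: field_simps)
  qed

  have "(exp (- defect * t) - 1) * \<Phi> \<le> (T1 - \<Phi>) + exp \<bar>defect\<bar> * (\<bar>t\<bar> / R * energy)"
    using T1_ge by simp
  also have "T1 - \<Phi> = G + H + D - (T2 - T3)" using balance by simp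
  also have "\<dots> \<le> \<bar>t\<bar> / R * energy + \<bar>t\<bar> / R * energy + M * \<bar>t\<bar> * (\<integral>x. \<bar>V.dens_dil t x - V.dens x\<bar> * v x \<partial>lborel)
      + \<bar>t\<bar> * (2 * C * energy / R + near_energy R)"
    using G_le H_le D_le T23 by simp
  also have "\<dots> + exp \<bar>defect\<bar> * (\<bar>t\<bar> / R * energy) =
      \<bar>t\<bar> * ((2 + exp \<bar>defect\<bar> + 2 * C) * energy / R + near_energy R
        + M * (\<integral>x. \<bar>V.dens_dil t x - V.dens x\<bar> * v x \<partial>lborel))"
    by (simp add: algebra_simps add_divide_distrib)
  finally show ?thesis by (simp add: \<Phi>_def \<phi>_def)
qed

lemma defect_eq_0:
  assumes pos: "energy > 0"
  shows "defect = 0"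
proof (rule ccontr)
  assume nz: "defect \<noteq> 0"
  \<comment> \<open>The sign makes - \<open>defect\<close> s k positive, and the shift by 8 keeps |s
    k| \<le> 1/8, as \<open>dilation_inequality\<close> requires.\<close>
  define s where "s k = - sgn defect / (real k + 8)" for k
  have s_abs: "\<bar>s k\<bar> = 1 / (real k + 8)" for k
    using nz by (simp add: s_def abs_mult abs_sgn_eq abs_div)
  have s_nz: "s k \<noteq> 0" for k using s_abs[of k] by auto
  have s_lim: "s \<longlonglongrightarrow> 0"
  proof -
    have "(\<lambda>k. 1 / (real k + 8)) \<longlonglongrightarrow> 0" by real_asymp
    then show ?thesis by (intro tendsto_rabs_zero_cancel[of s]) (simp add: s_abs)
  qed
  have sdef: "- defect * s k = \<bar>defect\<bar> * \<bar>s k\<bar>" for k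
    unfolding s_abs by (simp add: s_def linordered_idom_class.abs_sgn)
  have eps: "(\<lambda>k. \<integral>x. \<bar>V.dens_dil (s k) x - V.dens x\<bar> * v x \<partial>lborel) \<longlonglongrightarrow> 0"
    using v_cont v_pos s_lim s_nz by (rule V.integral_dens_dil_diff_tendsto)
  define \<Phi> where "\<Phi> R = (\<integral>\<xi>. log_cutoff R (norm \<xi>) * U.pdens \<xi> \<partial>lborel)" for R
  have \<Phi>0: "\<Phi> R \<ge> 0" for R
    unfolding \<Phi>_def by (intro Bochner_Integration.integral_nonneg) (simp add: U.dens_nonneg)
  \<comment> \<open>R, and with it M, is fixed while k tends to infinity. Since exp y - 1 \<ge> y,
    the left side is at least linear in |s k|; dividing by |s k| leaves an inequality in which only
    the term with M depends on k.\<close>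
  have bound: "\<bar>defect\<bar> * \<Phi> R \<le> (2 + exp \<bar>defect\<bar> + 2 * C) * energy / R + near_energy R" if R: "R \<ge> 1" for R
  proof -
    from dens_dil_diff_le[of "exp R"] obtain M where M: "M \<ge> 0"
      "\<And>t \<xi>. \<bar>t\<bar> \<le> 1 \<Longrightarrow> norm \<xi> \<le> exp R \<Longrightarrow> \<bar>U.dens_dil t \<xi> - U.dens \<xi>\<bar> \<le> M * \<bar>t\<bar> * U.dens \<xi>"
      by blast
    have "\<bar>defect\<bar> * \<Phi> R \<le> (2 + exp \<bar>defect\<bar> + 2 * C) * energy / R + near_energy R
          + M * (\<integral>x. \<bar>V.dens_dil (s k) x - V.dens x\<bar> * v x \<partial>lborel)" (is "_ \<le> ?B k") for k
    proof -
      have t: "\<bar>s k\<bar> \<le> 1/8" by (simp add: s_abs)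
      have "\<bar>defect\<bar> * \<bar>s k\<bar> \<le> exp (- defect * s k) - 1"
        unfolding sdef using exp_ge_add_one_self[of "\<bar>defect\<bar> * \<bar>s k\<bar>"] by linarith
      then have "\<bar>defect\<bar> * \<bar>s k\<bar> * \<Phi> R \<le> (exp (- defect * s k) - 1) * \<Phi> R"
        using \<Phi>0 by (intro mult_right_mono) auto
      also have "\<dots> \<le> \<bar>s k\<bar> * ?B k"
        unfolding \<Phi>_def using t M by (intro dilation_inequality R) auto
      finally have "\<bar>s k\<bar> * (\<bar>defect\<bar> * \<Phi> R) \<le> \<bar>s k\<bar> * ?B k" by (simp add: mult_ac)
      then show ?thesis using s_nz[of k] by (simp add: mult_le_cancel_left_pos)
    qed
    moreover have "(\<lambda>k. (2 + exp \<bar>defect\<bar> + 2 * C) * energy / R + near_energy R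
          + M * (\<integral>x. \<bar>V.dens_dil (s k) x - V.dens x\<bar> * v x \<partial>lborel))
        \<longlonglongrightarrow> (2 + exp \<bar>defect\<bar> + 2 * C) * energy / R + near_energy R + M * 0"
      by (intro tendsto_intros eps)
    ultimately show ?thesis using LIMSEQ_le_const[of _ "(2 + exp \<bar>defect\<bar> + 2 * C) * energy / R + near_energy R + M * 0"] by auto
  qed
  have \<Phi>_lim: "(\<lambda>j. \<Phi> (real (Suc j))) \<longlonglongrightarrow> energy"
    unfolding \<Phi>_def energy_def
  proof (rule integral_dominated_convergence[where w = U.pdens])
    have "(\<lambda>j. log_cutoff (real (Suc j)) (norm \<xi>) * U.pdens \<xi>) \<longlonglongrightarrow> 1 * U.pdens \<xi>" for \<xi>
      by (intro tendsto_mult log_cutoff_tendsto tendsto_const)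
    then show "AE \<xi> in lborel. (\<lambda>j. log_cutoff (real (Suc j)) (norm \<xi>) * U.pdens \<xi>) \<longlonglongrightarrow> U.pdens \<xi>"
      by simp
  qed (use U.integrable_pdens U.dens_nonneg in \<open>auto simp: abs_mult intro!: mult_left_le_one_le\<close>)
  have lim_R: "(\<lambda>j. (2 + exp \<bar>defect\<bar> + 2 * C) * energy * inverse (real (Suc j)) + near_energy (real (Suc j)))
      \<longlonglongrightarrow> (2 + exp \<bar>defect\<bar> + 2 * C) * energy * 0 + 0"
    by (intro tendsto_intros LIMSEQ_inverse_real_of_nat near_energy_tendsto)
  have lim_L: "(\<lambda>j. \<bar>defect\<bar> * \<Phi> (real (Suc j))) \<longlonglongrightarrow> \<bar>defect\<bar> * energy"
    by (intro tendsto_intros \<Phi>_lim)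
  have "\<bar>defect\<bar> * energy \<le> (2 + exp \<bar>defect\<bar> + 2 * C) * energy * 0 + 0"
    by (rule LIMSEQ_le[OF lim_L lim_R]) (use bound in \<open>simp add: divide_inverse\<close>)
  then show False using nz pos by (simp add: mult_le_0_iff)
qed

end

end

section \<open>The integral system on the half space\<close>

lemma open_upper_half: "open upper_half"
  unfolding upper_half_def by (intro open_Collect_less continuous_intros)

lemma C1_on_imp_continuous_on:
  assumes "C1_on S f"
  shows "continuous_on S f"
  using assms unfolding C1_on_def
  by (meson continuous_at_imp_continuous_on has_derivative_continuous)

text \<open>For |t| \<le> 1 both points lie in the ball of radius exp 1 times \<rho>. There the
  derivative of ln u is bounded by compactness, and the mean value inequality on this convex set
  applies.\<close>

lemma C1_on_imp_ln_dilation_lipschitz: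
  fixes u :: "'a::euclidean_space \<Rightarrow> real"
  assumes C1: "C1_on UNIV u" and pos: "\<And>x. u x > 0"
  shows "\<exists>L\<ge>0. \<forall>t x. \<bar>t\<bar> \<le> 1 \<longrightarrow> norm x \<le> \<rho> \<longrightarrow> \<bar>ln (u (exp t *\<^sub>R x)) - ln (u x)\<bar> \<le> L * \<bar>t\<bar>"
proof -
  obtain D where D: "\<And>x. (u has_derivative blinfun_apply (D x)) (at x)" "continuous_on UNIV D"
    using C1 by (auto simp: C1_on_def)
  have ucont: "continuous_on UNIV u" using C1 by (rule C1_on_imp_continuous_on)
  define E where "E x = inverse (u x) *\<^sub>R D x" for x
  have E: "((\<lambda>x. ln (u x)) has_derivative blinfun_apply (E x)) (at x)" for x
    unfolding E_def
    by (rule has_derivative_eq_rhs[OF has_derivative_ln[OF pos D(1)]])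
      (simp_all add: pos blinfun.scaleR_left fun_eq_iff divide_inverse)
  have "continuous_on UNIV E" unfolding E_def
    by (intro continuous_intros ucont D) (use pos in \<open>auto simp: less_imp_neq[THEN not_sym]\<close>)
  then have "compact (E ` cball 0 (exp 1 * \<rho>))"
    by (intro compact_continuous_image compact_cball) (rule continuous_on_subset, auto)
  then obtain B where B: "B > 0" "\<And>x. x \<in> cball 0 (exp 1 * \<rho>) \<Longrightarrow> norm (E x) \<le> B"
    using compact_imp_bounded bounded_pos by (metis imageI)
  have "\<bar>ln (u (exp t *\<^sub>R x)) - ln (u x)\<bar> \<le> (B * (exp 1 * \<bar>\<rho>\<bar>)) * \<bar>t\<bar>" if t: "\<bar>t\<bar> \<le> 1" and x: "norm x \<le> \<rho>" for t x
  proof -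
    have "\<rho> \<ge> 0" using x norm_ge_zero order_trans by blast
    have "norm x \<le> exp 1 * norm x" using mult_right_mono[of 1 "exp 1" "norm x"] by simp
    also have "\<dots> \<le> exp 1 * \<rho>" using x by simp
    finally have x1: "x \<in> cball 0 (exp 1 * \<rho>)" by simp
    have "exp t * norm x \<le> exp 1 * \<rho>" using t x by (intro mult_mono) auto
    then have x2: "exp t *\<^sub>R x \<in> cball 0 (exp 1 * \<rho>)" by simp
    have "norm (ln (u (exp t *\<^sub>R x)) - ln (u x)) \<le> B * norm (exp t *\<^sub>R x - x)"
      by (rule differentiable_bound[OF convex_cball has_derivative_at_withinI[OF E] _ x2 x1])
        (use B(2) in \<open>simp add: norm_blinfun.rep_eq\<close>)
    also have "norm (exp t *\<^sub>R x - x) = \<bar>exp t - 1\<bar> * norm x"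
      by (simp flip: norm_scaleR add: scaleR_left_diff_distrib)
    also have "B * \<dots> \<le> B * ((\<bar>t\<bar> * exp 1) * \<rho>)"
      using B(1) t x by (intro mult_left_mono mult_mono abs_exp_minus_one_le) auto
    finally show ?thesis using \<open>\<rho> \<ge> 0\<close> by (simp add: mult_ac)
  qed
  then show ?thesis using B(1) by (intro exI[of _ "B * (exp 1 * \<bar>\<rho>\<bar>)"]) auto
qed

lemma measurable_half_space_kernel [measurable]:
  "(\<lambda>(\<xi> :: real^'m, x). half_space_kernel \<sigma> \<xi> x) \<in> borel_measurable (lborel \<Otimes>\<^sub>M lborel)"
  and measurable_dist_boundary:
  "(\<lambda>(\<xi> :: real^'m, x). dist x (\<xi>, 0 :: real)) \<in> borel_measurable (lborel \<Otimes>\<^sub>M lborel)"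
proof -
  have "(\<lambda>y :: (real^'m) \<times> (real^'m) \<times> real. dist (snd y) (fst y, 0)) \<in> borel_measurable borel"
    by (intro borel_measurable_continuous_onI continuous_intros)
  then show [measurable]: "(\<lambda>(\<xi> :: real^'m, x). dist x (\<xi>, 0 :: real)) \<in> borel_measurable (lborel \<Otimes>\<^sub>M lborel)"
    by (simp add: lborel_prod case_prod_unfold)
  have "(\<lambda>x :: (real^'m) \<times> real. indicator upper_half x * snd x :: real) \<in> borel_measurable borel"
    by (intro borel_measurable_times borel_measurable_indicator borel_measurable_continuous_onI
        continuous_intros borel_open open_upper_half)
  then have [measurable]: "(\<lambda>(\<xi> :: real^'m, x :: (real^'m) \<times> real). indicator upper_half x * snd x :: real) \<in> borel_measurable (lborel \<Otimes>\<^sub>M lborel)"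
    by measurable
  have "(\<lambda>(\<xi>, x). half_space_kernel \<sigma> \<xi> x) =
      (\<lambda>y. (case y of (\<xi> :: real^'m, x) \<Rightarrow> indicator upper_half x * snd x) * (case y of (\<xi>, x) \<Rightarrow> dist x (\<xi>, 0)) powr (-\<sigma>))"
    by (auto simp: half_space_kernel_def fun_eq_iff)
  also have "\<dots> \<in> borel_measurable (lborel \<Otimes>\<^sub>M lborel)" by measurable
  finally show "(\<lambda>(\<xi> :: real^'m, x). half_space_kernel \<sigma> \<xi> x) \<in> borel_measurable (lborel \<Otimes>\<^sub>M lborel)" .
qed

lemma norm_powr_scaleR:
  "norm (exp t *\<^sub>R x) powr (-\<alpha>) = exp (-\<alpha> * t) * norm x powr (-\<alpha>)"
  by (simp add: powr_mult exp_powr_real mult.commute)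

theorem theorem1p9:
  fixes u :: "real^'m \<Rightarrow> real" and v :: "(real^'m) \<times> real \<Rightarrow> real"
    and \<gamma> \<alpha> \<beta> p0 q0 :: real
  defines "n \<equiv> real (CARD('m) + 1)"
  assumes n3: "CARD('m) + 1 \<ge> 3"
    and gam: "2 < \<gamma>" "\<gamma> < n"
    and p0: "0 < p0" and q0: "0 < q0"
    and u_C1: "C1_on UNIV u" and u_pos: "\<forall>\<xi>. u \<xi> > 0"
    and v_C1: "C1_on upper_half v" and v_pos: "\<forall>x\<in>upper_half. v x > 0"
    and u_L: "(\<integral>\<^sup>+ \<xi>. ennreal (norm \<xi> powr (-\<alpha>) * u \<xi> powr (p0 + 1)) \<partial>lborel) < \<infinity>"
    and v_L: "(\<integral>\<^sup>+ x. ennreal (indicator upper_half x * norm x powr (-\<beta>) * v x powr (q0 + 1)) \<partial>lborel) < \<infinity>"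
    and u_eq: "\<forall>\<xi>. ennreal (u \<xi>) =
        (\<integral>\<^sup>+ x. ennreal (indicator upper_half x * Pker x \<xi> \<gamma> * norm x powr (-\<beta>) * v x powr q0) \<partial>lborel)"
    and v_eq: "\<forall>x\<in>upper_half. ennreal (v x) =
        (\<integral>\<^sup>+ \<xi>. ennreal (Pker x \<xi> \<gamma> * norm \<xi> powr (-\<alpha>) * u \<xi> powr p0) \<partial>lborel)"
  shows "(n - 1 - \<alpha>) / (p0 + 1) + (n - \<beta>) / (q0 + 1) = n + 1 - \<gamma>"
proof -
  define w where "w \<xi> = norm \<xi> powr (-\<alpha>)" for \<xi> :: "real^'m"
  define z where "z x = indicator upper_half x * norm x powr (-\<beta>)" for x :: "(real^'m) \<times> real"
  \<comment> \<open>v is arbitrary outside the open half space. Its extension by zero satisfies the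
    second equation everywhere, because the kernel vanishes there as well.\<close>
  define v' where "v' x = indicator upper_half x * v x" for x
  define \<sigma> where "\<sigma> = n + 2 - \<gamma>"
  have \<sigma>: "\<sigma> \<ge> 0" using gam by (simp add: \<sigma>_def)
  define c where "c = (DIM((real^'m) \<times> real) - \<beta>) / (q0 + 1)"
  define C1 where "C1 = (\<bar>c\<bar> + 1 + 4 * \<sigma>) * exp (\<bar>c\<bar> + 1 + \<sigma>)"
  have C1: "C1 \<ge> 0" using \<sigma> by (simp add: C1_def)
  \<comment> \<open>This is the factor C * A from \<open>half_space_kernel_dilation_diff\<close>,
    for the exponent c that occurs in \<open>Kdil\<close>.\<close>
  define Q where "Q R \<xi> x = C1 * ((1 + norm x / dist x (\<xi>, 0)) * \<bar>log_cutoff R (norm x) - log_cutoff R (norm \<xi>)\<bar>)"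
    for R and \<xi> :: "real^'m" and x :: "(real^'m) \<times> real"
  have UH [measurable]: "upper_half \<in> sets borel" by (rule borel_open[OF open_upper_half])
  have uc: "continuous_on UNIV u" using u_C1 by (rule C1_on_imp_continuous_on)
  have vc: "continuous_on upper_half v" using v_C1 by (rule C1_on_imp_continuous_on)
  have ker: "indicator upper_half x * Pker x \<xi> \<gamma> = half_space_kernel \<sigma> \<xi> x" for x and \<xi> :: "real^'m"
    by (simp only: Pker_eq_half_space_kernel \<sigma>_def n_def)
  have v'_meas: "v' \<in> borel_measurable borel"
    using borel_measurable_continuous_on_indicator[OF UH vc] by (simp add: v'_def[abs_def])
  interpret U: weighted_power w u p0 \<alpha>
  proof
    show w_meas: "w \<in> borel_measurable borel" unfolding w_def[abs_def] by measurable
    show u_meas: "u \<in> borel_measurable borel" using uc by (rule borel_measurable_continuous_onI)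
    show "w (exp t *\<^sub>R x) = exp (-\<alpha> * t) * w x" for t x unfolding w_def by (rule norm_powr_scaleR)
    show "integrable lborel (\<lambda>x. w x * u x powr (p0 + 1))"
    proof (rule integrableI_nonneg)
      show "(\<lambda>x. w x * u x powr (p0 + 1)) \<in> borel_measurable lborel"
        using w_meas u_meas by measurable
    qed (use u_L in \<open>simp_all add: w_def\<close>)
  qed (use p0 u_pos in \<open>auto simp: w_def less_imp_le\<close>)
  interpret V: weighted_power z v' q0 \<beta>
  proof
    show z_meas: "z \<in> borel_measurable borel" unfolding z_def[abs_def] by measurable
    show "v' \<in> borel_measurable borel" by (rule v'_meas)
    show "z (exp t *\<^sub>R x) = exp (-\<beta> * t) * z x" for t x
      unfolding z_def norm_powr_scaleR by (simp add: indicator_def upper_half_scaleR_iff)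
    have eq: "z x * v' x powr (q0 + 1) = indicator upper_half x * norm x powr (-\<beta>) * v x powr (q0 + 1)" for x
      by (simp add: z_def v'_def indicator_def)
    show "integrable lborel (\<lambda>x. z x * v' x powr (q0 + 1))"
    proof (rule integrableI_nonneg)
      show "(\<lambda>x. z x * v' x powr (q0 + 1)) \<in> borel_measurable lborel"
        using z_meas v'_meas by measurable
      show "(\<integral>\<^sup>+x. ennreal (z x * v' x powr (q0 + 1)) \<partial>lborel) < \<infinity>"
        unfolding eq by (rule v_L)
    qed (simp add: z_def)
  qed (use q0 v_pos in \<open>auto simp: z_def v'_def indicator_def less_imp_le\<close>)
  \<comment> \<open>The degree \<sigma> - 1 equals n + 1 - \<gamma>, the right-hand side of the
    claim. The constants 9 and 3 come from \<open>half_space_kernel_dilation_diff\<close> and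
    \<open>relative_cutoff_bound\<close>.\<close>
  interpret dilation_system w u p0 \<alpha> z v' q0 \<beta> "half_space_kernel \<sigma>" "\<sigma> - 1" 9 "C1 * 3" Q
  proof
    show "half_space_kernel \<sigma> (exp t *\<^sub>R \<xi>) (exp t *\<^sub>R x) = exp (- (\<sigma> - 1) * t) * half_space_kernel \<sigma> \<xi> x"
      for t \<xi> and x :: "(real^'m) \<times> real"
      by (simp add: half_space_kernel_scaleR exp_powr_real algebra_simps)
    show "ennreal (u \<xi>) = (\<integral>\<^sup>+x. ennreal (half_space_kernel \<sigma> \<xi> x * V.dens x) \<partial>lborel)" for \<xi>
    proof -
      have "half_space_kernel \<sigma> \<xi> x * V.dens x =
          indicator upper_half x * Pker x \<xi> \<gamma> * norm x powr (-\<beta>) * v x powr q0" for x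
        unfolding ker[symmetric] V.dens_def by (simp add: z_def v'_def indicator_def)
      then show ?thesis using u_eq by simp
    qed
    show "ennreal (v' x) = (\<integral>\<^sup>+\<xi>. ennreal (half_space_kernel \<sigma> \<xi> x * U.dens \<xi>) \<partial>lborel)" for x
    proof (cases "x \<in> upper_half")
      case True
      have "half_space_kernel \<sigma> \<xi> x * U.dens \<xi> = Pker x \<xi> \<gamma> * norm \<xi> powr (-\<alpha>) * u \<xi> powr p0" for \<xi>
        unfolding ker[symmetric] U.dens_def using True by (simp add: w_def)
      then show ?thesis using v_eq True by (simp add: v'_def)
    qed (simp add: v'_def half_space_kernel_def)
    show "\<exists>L\<ge>0. \<forall>t \<xi>. \<bar>t\<bar> \<le> 1 \<longrightarrow> norm \<xi> \<le> \<rho> \<longrightarrow> \<bar>ln (u (exp t *\<^sub>R \<xi>)) - ln (u \<xi>)\<bar> \<le> L * \<bar>t\<bar>" for \<rho>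
      using u_C1 u_pos by (intro C1_on_imp_ln_dilation_lipschitz) auto
    show "v' x > 0" if "z x \<noteq> 0" for x
      using that v_pos by (auto simp: z_def v'_def indicator_def split: if_splits)
    show "((\<lambda>t. v' (exp t *\<^sub>R x)) \<longlongrightarrow> v' x) (at 0)" if "z x \<noteq> 0" for x
    proof -
      have x: "x \<in> upper_half" using that by (auto simp: z_def indicator_def split: if_splits)
      have "isCont v x" using vc x continuous_on_eq_continuous_at[OF open_upper_half] by blast
      moreover have "((\<lambda>t. exp t *\<^sub>R x) \<longlongrightarrow> exp 0 *\<^sub>R x) (at 0)" by (intro tendsto_intros)
      ultimately have "((\<lambda>t. v (exp t *\<^sub>R x)) \<longlongrightarrow> v x) (at 0)"
        by (intro isCont_tendsto_compose[of x v]) simp_all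
      then show ?thesis using x by (simp add: v'_def upper_half_scaleR_iff)
    qed
    show "(\<lambda>(\<xi>, x). Q R \<xi> x) \<in> borel_measurable (lborel \<Otimes>\<^sub>M lborel)" for R
    proof -
      note [measurable] = measurable_dist_boundary
      have "(\<lambda>(\<xi>, x). Q R \<xi> x) = (\<lambda>y. C1 * ((1 + norm (snd y) / (case y of (\<xi>, x) \<Rightarrow> dist x (\<xi>, 0))) *
          \<bar>log_cutoff R (norm (snd y)) - log_cutoff R (norm (fst y))\<bar>))"
        by (auto simp: Q_def fun_eq_iff)
      also have "\<dots> \<in> borel_measurable (lborel \<Otimes>\<^sub>M lborel)" by measurable
      finally show ?thesis .
    qed
    show "Q R \<xi> x \<ge> 0" for R \<xi> x using C1 by (simp add: Q_def)
    show "Q R \<xi> x \<le> C1 * 3" if "R \<ge> 1" for R \<xi> x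
      unfolding Q_def using relative_cutoff_bound[OF that] C1 by (intro mult_left_mono)
    show "(\<lambda>k. Q (real (Suc k)) \<xi> x) \<longlonglongrightarrow> 0" for \<xi> x
    proof -
      have "(\<lambda>k. Q (real (Suc k)) \<xi> x) \<longlonglongrightarrow> C1 * ((1 + norm x / dist x (\<xi>, 0)) * \<bar>1 - 1\<bar>)"
        unfolding Q_def by (intro tendsto_mult tendsto_const tendsto_rabs tendsto_diff log_cutoff_tendsto)
      then show ?thesis by simp
    qed
    show "\<bar>kt * (log_cutoff R (norm (exp (-t) *\<^sub>R x)) - log_cutoff R (norm \<xi>))
        - half_space_kernel \<sigma> \<xi> x * (log_cutoff R (norm x) - log_cutoff R (norm \<xi>))\<bar>
      \<le> \<bar>t\<bar> * (9 / R * (kt + half_space_kernel \<sigma> \<xi> x) + Q R \<xi> x * half_space_kernel \<sigma> \<xi> x)"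
      if "R \<ge> 1" "\<bar>t\<bar> \<le> 1/8"
        "kt = exp (- ((DIM((real^'m) \<times> real) - \<beta>) / (q0 + 1)) * t) * half_space_kernel \<sigma> \<xi> (exp (-t) *\<^sub>R x)"
      for R t kt \<xi> x
      using half_space_kernel_dilation_diff[OF that(1) \<sigma> that(2), of c \<xi> x]
      unfolding that(3) c_def[symmetric] Q_def C1_def by simp
  qed (use u_pos in \<open>auto simp: half_space_kernel_nonneg\<close>)
  \<comment> \<open>The density \<open>U.pdens\<close> is positive off the origin. At the origin the
    weight is 0, since 0 powr anything is 0, but a single point is a null set.\<close>
  have "energy > 0"
  proof (rule ccontr)
    assume "\<not> energy > 0"
    then have "energy = 0" using energy_nonneg by simp
    then have "AE \<xi> in lborel. U.pdens \<xi> = 0"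
      unfolding energy_def using integral_nonneg_eq_0_iff_AE[OF U.integrable_pdens] U.dens_nonneg by simp
    moreover have "AE \<xi>::real^'m in lborel. \<xi> \<noteq> 0" by (rule AE_lborel_singleton)
    ultimately have "AE \<xi>::real^'m in lborel. False"
    proof eventually_elim
      case (elim \<xi>)
      then show ?case using u_pos[rule_format, of \<xi>] by (simp add: U.pdens_def w_def)
    qed
    then have "emeasure lborel (space (lborel :: (real^'m) measure)) = 0"
      by (simp add: eventually_False ae_filter_eq_bot_iff)
    then show False by simp
  qed
  then have "defect = 0" by (rule defect_eq_0)
  then show ?thesis unfolding defect_def by (simp add: \<sigma>_def n_def algebra_simps)
qed

end
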